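(* Let $d\ge2$, $0\le r_0<r_1\le\infty$, and let $f:A(r_0,r_1)\to\mathbb{C}$ be polyharmonic of infinite order and type $\tau\ge0$. Let $\widetilde f_{k,l}(v)=f_{k,l}(e^v)$ for $v\in(\log r_0,\log r_1)$. Then for every $v_0\in(\log r_0,\log r_1)$ and every $\varepsilon>0$ there is a constant $C>0$ such that $$\left|D^{(n)}\widetilde f_{k,l}(v_0)\right|\le C\,n!\,\left[e^{v_0}(\tau+\varepsilon)\right]^n$$ for all $n\in\mathbb{N}_0$, all $k\in\mathbb{N}_0$ and all $l=1,\dots,a_k$, where $D^{(n)}$ is taken with respect to the exponents $\lambda_j=\lambda_j(k,d)$.
   Context: $A(r_0,r_1)=\{x\in\mathbb{R}^d: r_0<|x|<r_1\}$ ($\log 0=-\infty$). A function $f:G\to\mathbb{C}$ on a domain $G\subset\mathbb{R}^d$ is polyharmonic of infinite order and type $\tau\ge0$ if $f\in C^\infty(G)$ and for every compact $K\subset G$ and every $\varepsilon>0$ there is $C_{K,\varepsilon}>0$ with $\max_{x\in K}|\Delta^p f(x)|\le C_{K,\varepsilon}(2p)!(\tau+\varepsilon)^{2p}$ for all $p\in\mathbb{N}_0$. $Y_{k,l}$, $l=1,\dots,a_k$, is an orthonormal basis (in $L^2(\mathbb{S}^{d-1},d\theta)$, $d\theta$ the rotation-invariant surface measure) of the harmonic homogeneous polynomials of degree $k$, and $f_{k,l}(r)=\int_{\mathbb{S}^{d-1}}f(r\theta)\overline{Y_{k,l}(\theta)}d\theta$. For $k\in\mathbb{N}_0$ the exponents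 are $\lambda_{2j}(k,d)=k+2j$, $\lambda_{2j+1}(k,d)=-k-d+2+2j$ ($j\in\mathbb{N}_0$), and $D^{(n)}g=(\frac{d}{dv}-\lambda_0)\cdots(\frac{d}{dv}-\lambda_{n-1})g$, $D^{(0)}g=g$. *)

theory Defs
  imports "HOL-Analysis.Analysis"
begin

definition partial :: "'n::finite \<Rightarrow> (real^'n \<Rightarrow> complex) \<Rightarrow> real^'n \<Rightarrow> complex" where
  "partial i g x = vector_derivative (\<lambda>t. g (x + t *\<^sub>R axis i 1)) (at 0)"

fun pderivs :: "'n::finite list \<Rightarrow> (real^'n \<Rightarrow> complex) \<Rightarrow> real^'n \<Rightarrow> complex" where
  "pderivs [] g = g"
| "pderivs (i # is) g = partial i (pderivs is g)"

definition smooth_on :: "(real^'n::finite) set \<Rightarrow> (real^'n \<Rightarrow> complex) \<Rightarrow> bool" where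
  "smooth_on G g \<longleftrightarrow>
     (\<forall>is. continuous_on G (pderivs is g)) \<and>
     (\<forall>is i. \<forall>x\<in>G. (\<lambda>t. pderivs is g (x + t *\<^sub>R axis i 1)) differentiable (at 0))"

definition laplacian :: "(real^'n::finite \<Rightarrow> complex) \<Rightarrow> real^'n \<Rightarrow> complex" where
  "laplacian g x = (\<Sum>i\<in>UNIV. partial i (partial i g) x)"

definition polyharmonic_inf :: "(real^'n::finite) set \<Rightarrow> real \<Rightarrow> (real^'n \<Rightarrow> complex) \<Rightarrow> bool" where
  "polyharmonic_inf G \<tau> f \<longleftrightarrow> smooth_on G f \<and>
     (\<forall>K. compact K \<and> K \<subseteq> G \<longrightarrow> (\<forall>\<epsilon>>0. \<exists>C>0. \<forall>p::nat. \<forall>x\<in>K.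
        cmod ((laplacian ^^ p) f x) \<le> C * fact (2*p) * (\<tau> + \<epsilon>) ^ (2*p)))"

definition annulus :: "real \<Rightarrow> ereal \<Rightarrow> (real^'n::finite) set" where
  "annulus r0 r1 = {x. r0 < norm x \<and> ereal (norm x) < r1}"

definition hom_poly :: "nat \<Rightarrow> (real^'n::finite \<Rightarrow> complex) \<Rightarrow> bool" where
  "hom_poly k p \<longleftrightarrow> (\<exists>c :: ('n \<Rightarrow> nat) \<Rightarrow> complex.
     p = (\<lambda>x. \<Sum>\<alpha>\<in>{\<alpha>. sum \<alpha> UNIV = k}. c \<alpha> * (\<Prod>i\<in>UNIV. complex_of_real (x $ i) ^ \<alpha> i)))"

definition harm_hom_poly :: "nat \<Rightarrow> (real^'n::finite \<Rightarrow> complex) \<Rightarrow> bool" where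
  "harm_hom_poly k p \<longleftrightarrow> hom_poly k p \<and> (\<forall>x. laplacian p x = 0)"

text \<open>Integral over the unit sphere w.r.t. the (unnormalised) rotation-invariant surface
  measure, via the cone formula: integral over S^{d-1} of h equals d times the Lebesgue
  integral over the unit ball of h(x/|x|).\<close>
definition sphere_integral :: "(real^'n::finite \<Rightarrow> complex) \<Rightarrow> complex" where
  "sphere_integral h = of_nat CARD('n) * (LINT x:ball 0 1|lborel. h (x /\<^sub>R norm x))"

definition sph_inner :: "(real^'n::finite \<Rightarrow> complex) \<Rightarrow> (real^'n \<Rightarrow> complex) \<Rightarrow> complex" where
  "sph_inner p q = sphere_integral (\<lambda>\<theta>. p \<theta> * cnj (q \<theta>))"

definition sph_harm_onb :: "nat \<Rightarrow> nat \<Rightarrow> (nat \<Rightarrow> real^'n::finite \<Rightarrow> complex) \<Rightarrow> bool" where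
  "sph_harm_onb k m Y \<longleftrightarrow>
     (\<forall>l\<in>{1..m}. harm_hom_poly k (Y l)) \<and>
     (\<forall>l\<in>{1..m}. \<forall>l'\<in>{1..m}. sph_inner (Y l) (Y l') = (if l = l' then 1 else 0)) \<and>
     (\<forall>p. harm_hom_poly k p \<longrightarrow> (\<exists>c. \<forall>x. p x = (\<Sum>l=1..m. c l * Y l x)))"

definition fcoef :: "(real^'n::finite \<Rightarrow> complex) \<Rightarrow> (real^'n \<Rightarrow> complex) \<Rightarrow> real \<Rightarrow> complex" where
  "fcoef f Y r = sphere_integral (\<lambda>\<theta>. f (r *\<^sub>R \<theta>) * cnj (Y \<theta>))"

definition lam :: "nat \<Rightarrow> nat \<Rightarrow> nat \<Rightarrow> real" where
  "lam k d j = (if even j then real k + real j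
                else - real k - real d + 2 + 2 * real (j div 2))"

text \<open>Dop L n g = (d/dv - L 0) ... (d/dv - L (n-1)) g  (the factors commute).\<close>
fun Dop :: "(nat \<Rightarrow> real) \<Rightarrow> nat \<Rightarrow> (real \<Rightarrow> complex) \<Rightarrow> real \<Rightarrow> complex" where
  "Dop L 0 g = g"
| "Dop L (Suc n) g = (\<lambda>v. vector_derivative (Dop L n g) (at v) - complex_of_real (L n) * Dop L n g v)"

end

(* With the rotation fields L_ij = x_i d_j - x_j d_i and the Euler field E,
     |x|^2 Laplacian = E^2 + (d - 2) E + (1/2) sum_ij L_ij^2,
   and the L_ij are skew-adjoint on the sphere by rotation invariance of Lebesgue measure on the ball.
   Hence F_p(v) = (Laplacian^p f)_kl (e^v) satisfies
     (d/dv - k) (d/dv + k + d - 2) F_p = e^(2v) F_(p+1),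
   so D^(2p) F_0 = e^(2pv) F_p and D^(2p+1) F_0 = e^(2pv) (F_p' - k F_p).
   Even orders are bounded directly, uniformly in k and l since the Y_kl have norm 1.
   For odd orders G = F_p' - k F_p solves G' + mu G = e^(2v) F_(p+1) with mu = k + d - 2 >= k, and this
   sign makes a bound for G by F_p and F_(p+1) on an interval to the left independent of k. *)

theory Submission
  imports Defs
begin

text \<open>The hypothesis controls only the powers of the Laplacian. It gives no direct bound for
  the gradient of Laplacian^p f, hence none for F_p', and the term k F_p grows with k. So the two
  summands of F_p' - k F_p are not estimated separately: the differential equation recovers their
  difference from F_p and F_(p+1). The price is the factorial (2p+2)! = (2p+2) n! at order n = 2p+1;
  the extra linear factor is absorbed by using the hypothesis with half of the given epsilon.
  Rotation fields keep all calculus in Cartesian coordinates: integration by parts on the sphere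
  amounts to differentiating the constant function that sends t to the integral of u(R_t x). A
  second obstacle is that \<open>smooth_on\<close> supplies derivatives along the axes only, while
  rotations and dilations move points along other curves. The chain rule there needs the total
  derivative, which is rebuilt from the continuous partial derivatives.\<close>

subsection \<open>Spherical integrals\<close>

text \<open>At the origin the definition evaluates \<open>h\<close> at 0, which is off the sphere.
  Deleting this null point leaves an integrand determined by the values of \<open>h\<close> on the
  sphere, so continuity there is enough in what follows.\<close>

lemma sphere_integral_punctured:
  fixes h :: "real^'n \<Rightarrow> complex"
  shows "sphere_integral h =
    of_nat CARD('n) * (\<integral>x. indicator (ball 0 1 - {0}) x *\<^sub>R h (x /\<^sub>R norm x) \<partial>lborel)"
proof -
  have "(\<integral>x. indicator (ball 0 1) x *\<^sub>R h (x /\<^sub>R norm x) \<partial>lborel)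
      = (\<integral>x. indicator (ball 0 1 - {0}) x *\<^sub>R h (x /\<^sub>R norm x) \<partial>lborel)"
    by (rule integral_discrete_difference[where X="{0}"]) (auto simp: indicator_def)
  then show ?thesis
    by (simp add: sphere_integral_def set_lebesgue_integral_def)
qed

lemma borel_measurable_normalized:
  fixes h :: "real^'n \<Rightarrow> complex"
  assumes "continuous_on (sphere 0 1) h"
  shows "(\<lambda>x. indicator (ball 0 1 - {0}) x *\<^sub>R h (x /\<^sub>R norm x)) \<in> borel_measurable lborel"
proof -
  have "continuous_on (ball 0 1 - {0::real^'n}) (\<lambda>x. x /\<^sub>R norm x)"
    by (intro continuous_intros) auto
  then have "continuous_on (ball 0 1 - {0}) (\<lambda>x. h (x /\<^sub>R norm x))"
    by (rule continuous_on_compose2[OF assms]) (auto intro!: left_inverse)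
  from borel_measurable_continuous_on_indicator[OF _ this] show ?thesis
    by simp
qed

lemma integrable_normalized_bound:
  "integrable lborel (\<lambda>x::real^'n. M * indicator (ball 0 1 - {0}) x :: real)"
proof -
  have "ball 0 1 - {0::real^'n} \<in> fmeasurable lborel"
    by (rule fmeasurable.Diff) (auto simp: fmeasurable_def emeasure_lborel_ball_finite[unfolded infinity_ennreal_def])
  then have "integrable lborel (indicator (ball 0 1 - {0::real^'n}) :: _ \<Rightarrow> real)"
    by (simp add: fmeasurable_def)
  then show ?thesis
    by (rule integrable_mult_right)
qed

lemma integrable_normalized:
  fixes h :: "real^'n \<Rightarrow> complex"
  assumes "continuous_on (sphere 0 1) h"
  shows "integrable lborel (\<lambda>x. indicator (ball 0 1 - {0}) x *\<^sub>R h (x /\<^sub>R norm x))"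
proof -
  have "compact (h ` sphere 0 1)"
    using assms by (intro compact_continuous_image) auto
  then obtain M where M: "\<And>x. x \<in> sphere 0 1 \<Longrightarrow> cmod (h x) \<le> M"
    by (meson bounded_iff compact_imp_bounded imageI)
  show ?thesis
  proof (rule Bochner_Integration.integrable_bound[OF integrable_normalized_bound[of M]])
    show "AE x in lborel. norm (indicator (ball 0 1 - {0}) x *\<^sub>R h (x /\<^sub>R norm x))
        \<le> norm (M * indicator (ball 0 1 - {0::real^'n}) x)"
      by (rule AE_I2) (auto simp: indicator_def intro!: order_trans[OF M])
  qed (rule borel_measurable_normalized[OF assms])
qed

lemma sphere_integral_add:
  assumes "continuous_on (sphere 0 1) g" "continuous_on (sphere 0 1) h"
  shows "sphere_integral (\<lambda>x. g x + h x) = sphere_integral g + sphere_integral h"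
  using assms
  by (simp add: sphere_integral_punctured scaleR_add_right Bochner_Integration.integral_add
      integrable_normalized algebra_simps)

lemma sphere_integral_cmult:
  "sphere_integral (\<lambda>x. c * h x) = c * sphere_integral h"
  by (simp add: sphere_integral_punctured scaleR_conv_of_real mult.left_commute)

lemma sphere_integral_cong:
  fixes g :: "real^'n \<Rightarrow> complex"
  assumes "\<And>x. norm x = 1 \<Longrightarrow> g x = h x"
  shows "sphere_integral g = sphere_integral h"
  unfolding sphere_integral_punctured
  by (intro arg_cong2[where f="(*)"] refl Bochner_Integration.integral_cong)
    (auto simp: indicator_def intro!: assms)

lemma sphere_integral_sum:
  assumes "finite A" "\<And>i. i \<in> A \<Longrightarrow> continuous_on (sphere 0 1) (h i)"
  shows "sphere_integral (\<lambda>x. \<Sum>i\<in>A. h i x) = (\<Sum>i\<in>A. sphere_integral (h i))"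
  using assms
proof (induction A rule: finite_induct)
  case empty
  show ?case by (simp add: sphere_integral_def)
next
  case (insert i A)
  then show ?case by (simp add: sphere_integral_add continuous_on_sum)
qed

text \<open>The majorant \<open>w\<close> varies over the sphere because in
  \<open>norm_fcoef_le\<close> it contains |Y|^2, whose integral is known. It is embedded into the
  complex numbers to match the type of \<open>sphere_integral\<close>.\<close>

lemma norm_sphere_integral_le:
  fixes h :: "real^'n \<Rightarrow> complex"
  assumes h: "continuous_on (sphere 0 1) h" and w: "continuous_on (sphere 0 1) (\<lambda>x. complex_of_real (w x))"
    and le: "\<And>x. norm x = 1 \<Longrightarrow> cmod (h x) \<le> w x"
  shows "cmod (sphere_integral h) \<le> Re (sphere_integral (\<lambda>x. complex_of_real (w x)))"
proof -
  let ?I = "\<lambda>x::real^'n. indicator (ball 0 1 - {0}) x :: real"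
  have eq: "(\<lambda>x. ?I x *\<^sub>R complex_of_real (w (x /\<^sub>R norm x)))
      = (\<lambda>x. complex_of_real (?I x * w (x /\<^sub>R norm x)))"
    by (simp add: scaleR_conv_of_real)
  have "cmod (\<integral>x. ?I x *\<^sub>R h (x /\<^sub>R norm x) \<partial>lborel) \<le> (\<integral>x. ?I x * w (x /\<^sub>R norm x) \<partial>lborel)"
  proof (rule Bochner_Integration.integral_norm_bound_integral)
    show "integrable lborel (\<lambda>x. ?I x *\<^sub>R h (x /\<^sub>R norm x))"
      by (rule integrable_normalized[OF h])
    have "integrable lborel (\<lambda>x. complex_of_real (?I x * w (x /\<^sub>R norm x)))"
      using integrable_normalized[OF w] unfolding eq .
    then show "integrable lborel (\<lambda>x. ?I x * w (x /\<^sub>R norm x))"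
      using integrable_Re by fastforce
    show "cmod (?I x *\<^sub>R h (x /\<^sub>R norm x)) \<le> ?I x * w (x /\<^sub>R norm x)" for x
      using le[of "x /\<^sub>R norm x"] by (auto simp: indicator_def)
  qed
  then have "of_nat CARD('n) * cmod (\<integral>x. ?I x *\<^sub>R h (x /\<^sub>R norm x) \<partial>lborel)
      \<le> of_nat CARD('n) * (\<integral>x. ?I x * w (x /\<^sub>R norm x) \<partial>lborel)"
    by (intro mult_left_mono) auto
  then show ?thesis
    unfolding sphere_integral_punctured norm_mult eq integral_complex_of_real by simp
qed

section \<open>Differentiation under the spherical integral\<close>

lemma has_vector_derivative_iff_quotient:
  fixes f :: "real \<Rightarrow> 'a::real_normed_vector"
  shows "(f has_vector_derivative D) (at t) \<longleftrightarrow> ((\<lambda>s. (f s - f t) /\<^sub>R (s - t)) \<longlongrightarrow> D) (at t)"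
proof -
  have "norm (f s - f t - (s - t) *\<^sub>R D) / norm (s - t) = norm ((f s - f t) /\<^sub>R (s - t) - D)" if "s \<noteq> t" for s
  proof -
    have "(f s - f t) /\<^sub>R (s - t) - D = (f s - f t - (s - t) *\<^sub>R D) /\<^sub>R (s - t)"
      using that by (simp add: scaleR_diff_right)
    then show ?thesis
      by (simp add: divide_inverse mult.commute)
  qed
  then have "((\<lambda>s. norm (f s - f t - (s - t) *\<^sub>R D) / norm (s - t)) \<longlongrightarrow> 0) (at t) \<longleftrightarrow>
      ((\<lambda>s. norm ((f s - f t) /\<^sub>R (s - t) - D)) \<longlongrightarrow> 0) (at t)"
    by (intro filterlim_cong refl) (simp add: eventually_at_filter)
  then show ?thesis
    unfolding has_vector_derivative_def has_derivative_iff_norm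
    by (simp add: bounded_linear_scaleR_left tendsto_norm_zero_iff flip: Lim_null)
qed

text \<open>Dominated convergence for difference quotients: by the mean value inequality they are
  bounded by the maximum \<open>M\<close> of the derivative over the compact set [a,b] x sphere, and
  a constant is integrable over the ball.\<close>

lemma sphere_integral_has_vector_derivative:
  fixes \<phi> :: "real \<Rightarrow> real^'n \<Rightarrow> complex"
  assumes ab: "a < t0" "t0 < b"
    and deriv: "\<And>t x. a \<le> t \<Longrightarrow> t \<le> b \<Longrightarrow> norm x = 1 \<Longrightarrow>
      ((\<lambda>s. \<phi> s x) has_vector_derivative \<phi>' t x) (at t)"
    and cont: "\<And>t. a \<le> t \<Longrightarrow> t \<le> b \<Longrightarrow> continuous_on (sphere 0 1) (\<phi> t)"
    and cont': "continuous_on ({a..b} \<times> sphere 0 1) (\<lambda>(t, x). \<phi>' t x)"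
  shows "((\<lambda>t. sphere_integral (\<phi> t)) has_vector_derivative sphere_integral (\<phi>' t0)) (at t0)"
proof -
  have "compact ((\<lambda>(t, x). \<phi>' t x) ` ({a..b} \<times> sphere 0 1))"
    by (intro compact_continuous_image cont' compact_Times) auto
  then obtain M where M: "\<And>t x. a \<le> t \<Longrightarrow> t \<le> b \<Longrightarrow> norm x = 1 \<Longrightarrow> cmod (\<phi>' t x) \<le> M"
    unfolding bounded_iff[of "_ ` _"] by (fastforce dest!: compact_imp_bounded simp: bounded_iff)
  have cont0: "continuous_on (sphere 0 1) (\<phi>' t0)"
  proof -
    have "continuous_on (sphere 0 1) (\<lambda>x. (\<lambda>(t, x). \<phi>' t x) (t0, x))"
      by (rule continuous_on_compose2[OF cont']) (use ab in \<open>auto intro!: continuous_intros\<close>)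
    then show ?thesis by simp
  qed
  let ?Q = "\<lambda>t x. (\<phi> t x - \<phi> t0 x) /\<^sub>R (t - t0)"
  let ?I = "\<lambda>x::real^'n. indicator (ball 0 1 - {0}) x :: real"
  have Qlim: "((\<lambda>t. ?Q t x) \<longlongrightarrow> \<phi>' t0 x) (at t0)" if "norm x = 1" for x
    using deriv[of t0 x] ab that by (simp add: has_vector_derivative_iff_quotient)
  have Qbound: "cmod (?Q t x) \<le> M" if t: "a \<le> t" "t \<le> b" and x: "norm x = 1" for t x
  proof -
    have "cmod (\<phi> t x - \<phi> t0 x) \<le> M * norm (t - t0)"
    proof (rule differentiable_bound[where S="{a..b}" and f'="\<lambda>s h. h *\<^sub>R \<phi>' s x"])
      show "((\<lambda>s. \<phi> s x) has_derivative (\<lambda>h. h *\<^sub>R \<phi>' s x)) (at s within {a..b})" if "s \<in> {a..b}" for s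
        using deriv[of s x] that x
        by (auto simp: has_vector_derivative_def intro: has_derivative_at_withinI)
      show "onorm (\<lambda>h. h *\<^sub>R \<phi>' s x) \<le> M" if "s \<in> {a..b}" for s
        using M[of s x] that x by (simp add: onorm_scaleR_left onorm_id bounded_linear_ident)
    qed (use t ab in auto)
    moreover have "0 \<le> M"
      using M[of t x] t x norm_ge_zero order_trans by blast
    moreover have "cmod (?Q t x) = cmod (\<phi> t x - \<phi> t0 x) / \<bar>t - t0\<bar>"
      by (simp add: divide_inverse mult.commute)
    ultimately show ?thesis
      by (cases "t = t0") (simp_all add: divide_le_eq)
  qed
  have "((\<lambda>t. (sphere_integral (\<phi> t) - sphere_integral (\<phi> t0)) /\<^sub>R (t - t0)) \<longlongrightarrow> sphere_integral (\<phi>' t0)) (at t0)"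
  proof (subst tendsto_at_iff_sequentially, safe)
    fix X :: "nat \<Rightarrow> real"
    assume X: "\<forall>i. X i \<in> UNIV - {t0}" and lim: "X \<longlonglongrightarrow> t0"
    have ev: "eventually (\<lambda>i. X i \<in> {a<..<b}) sequentially"
      using lim ab by (intro topological_tendstoD) auto
    then obtain N where N: "\<And>i. i \<ge> N \<Longrightarrow> X i \<in> {a<..<b}"
      by (auto simp: eventually_sequentially)
    \<comment> \<open>Domination must hold for every index, so the first \<open>N\<close> terms,
      which may leave [a,b], are dropped; \<open>LIMSEQ_offset\<close> restores them at the
      end.\<close>
    define Z where "Z i = X (i + N)" for i
    have Z: "a \<le> Z i" "Z i \<le> b" "Z i \<noteq> t0" for i
      using N[of "i + N"] X by (auto simp: Z_def)
    have Zlim: "filterlim Z (at t0) sequentially"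
      using LIMSEQ_ignore_initial_segment[OF lim, of N] Z by (simp add: filterlim_at Z_def[abs_def])
    have contQ: "continuous_on (sphere 0 1) (?Q (Z i))" for i
      using Z ab by (intro continuous_intros cont) auto
    have "(\<lambda>i. \<integral>x. ?I x *\<^sub>R ?Q (Z i) (x /\<^sub>R norm x) \<partial>lborel)
        \<longlonglongrightarrow> (\<integral>x. ?I x *\<^sub>R \<phi>' t0 (x /\<^sub>R norm x) \<partial>lborel)"
    proof (rule integral_dominated_convergence)
      show "integrable lborel (\<lambda>x. M * ?I x)"
        by (rule integrable_normalized_bound)
      show "AE x in lborel. (\<lambda>i. ?I x *\<^sub>R ?Q (Z i) (x /\<^sub>R norm x)) \<longlonglongrightarrow> ?I x *\<^sub>R \<phi>' t0 (x /\<^sub>R norm x)"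
      proof (rule AE_I2)
        fix x :: "real^'n"
        show "(\<lambda>i. ?I x *\<^sub>R ?Q (Z i) (x /\<^sub>R norm x)) \<longlonglongrightarrow> ?I x *\<^sub>R \<phi>' t0 (x /\<^sub>R norm x)"
        proof (cases "x = 0")
          case False
          then show ?thesis
            by (intro tendsto_scaleR tendsto_const filterlim_compose[OF Qlim Zlim]) simp
        qed simp
      qed
      show "AE x in lborel. norm (?I x *\<^sub>R ?Q (Z i) (x /\<^sub>R norm x)) \<le> M * ?I x" for i
      proof (rule AE_I2)
        fix x :: "real^'n"
        show "norm (?I x *\<^sub>R ?Q (Z i) (x /\<^sub>R norm x)) \<le> M * ?I x"
          using Qbound[OF Z(1,2), of "x /\<^sub>R norm x" i] by (cases "x \<in> ball 0 1 - {0}") simp_all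
      qed
    qed (intro borel_measurable_normalized contQ cont0)+
    then have "(\<lambda>i. sphere_integral (?Q (Z i))) \<longlonglongrightarrow> sphere_integral (\<phi>' t0)"
      unfolding sphere_integral_punctured by (intro tendsto_mult tendsto_const)
    moreover have "sphere_integral (?Q (Z i)) = (sphere_integral (\<phi> (Z i)) - sphere_integral (\<phi> t0)) /\<^sub>R (Z i - t0)" for i
    proof -
      have "sphere_integral (?Q (Z i)) = sphere_integral (\<lambda>x. of_real (inverse (Z i - t0)) * (\<phi> (Z i) x + (-1) * \<phi> t0 x))"
        by (simp add: scaleR_conv_of_real)
      also have "\<dots> = of_real (inverse (Z i - t0)) * (sphere_integral (\<phi> (Z i)) - sphere_integral (\<phi> t0))"
        unfolding sphere_integral_cmult
        using Z[of i] ab sphere_integral_cmult[of "-1" "\<phi> t0"]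
        by (subst sphere_integral_add) (auto intro!: continuous_intros cont)
      finally show ?thesis by (simp add: scaleR_conv_of_real)
    qed
    ultimately have "(\<lambda>i. (sphere_integral (\<phi> (X (i + N))) - sphere_integral (\<phi> t0)) /\<^sub>R (X (i + N) - t0))
        \<longlonglongrightarrow> sphere_integral (\<phi>' t0)"
      by (simp add: Z_def)
    then show "((\<lambda>t. (sphere_integral (\<phi> t) - sphere_integral (\<phi> t0)) /\<^sub>R (t - t0)) \<circ> X)
        \<longlonglongrightarrow> sphere_integral (\<phi>' t0)"
      unfolding o_def by (rule LIMSEQ_offset)
  qed
  then show ?thesis
    by (simp add: has_vector_derivative_iff_quotient)
qed

section \<open>Rotation invariance of the spherical integral\<close>

text \<open>By the Vitali covering theorem an open set is, up to a null set, a disjoint union of balls, and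
  isometries preserve balls. (The results on images under linear maps in
  \<^theory>\<open>HOL-Analysis.Change_Of_Vars\<close> are restricted to well-ordered index types.)\<close>
lemma emeasure_lborel_le_vimage_orthogonal:
  fixes R :: "'a::euclidean_space \<Rightarrow> 'a"
  assumes R: "orthogonal_transformation R" and U: "open U"
  shows "emeasure lborel U \<le> emeasure lborel (R -` U)"
proof -
  define K where "K = {(c, r). 0 < r \<and> ball c r \<subseteq> U}"
  let ?B = "\<lambda>i. ball (fst i) (snd i)"
  have vit: "\<exists>i. i \<in> K \<and> x \<in> ball (fst i) (snd i) \<and> snd i < d" if x: "x \<in> U" and d: "0 < d" for x d
  proof -
    obtain e where "e > 0" "ball x e \<subseteq> U"
      using x U openE by blast
    then show ?thesis
      using d by (intro exI[of _ "(x, min e (d/2))"]) (auto simp: K_def)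
  qed
  obtain C where C: "countable C" "C \<subseteq> K"
    and disj: "pairwise (\<lambda>i j. disjnt (?B i) (?B j)) C"
    and neg: "negligible (U - (\<Union>i\<in>C. ?B i))"
    by (rule Vitali_covering_theorem_balls[of U K fst snd]) (use vit in blast)+
  have fam: "disjoint_family_on ?B C"
    using disj by (auto simp: pairwise_def disjnt_def disjoint_family_on_def)
  have bij: "bij R" and lin: "linear R" and nrm: "\<And>x. norm (R x) = norm x"
    using R by (auto simp: orthogonal_transformation_bij orthogonal_transformation)
  have ball: "R -` ball c r = ball (inv R c) r" for c r
  proof -
    have "dist c (R x) = dist (inv R c) x" for x
      using bij nrm[of "inv R c - x"] linear_diff[OF lin, of "inv R c" x]
      by (simp add: dist_norm bij_is_surj surj_f_inv_f)
    then show ?thesis by auto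
  qed
  have shift: "emeasure lborel (ball c r) = emeasure lborel (ball c' r)" for c c' :: 'a and r
  proof (cases "r \<le> 0")
    case False
    have "measure lborel (ball c r) = measure lborel (ball c' r)"
      using False content_ball_conv_unit_ball[of r c] content_ball_conv_unit_ball[of r c'] by simp
    then show ?thesis
      using emeasure_lborel_ball_finite[of c r] emeasure_lborel_ball_finite[of c' r]
      by (simp add: emeasure_eq_ennreal_measure)
  qed (simp add: ball_empty)
  have cover: "(\<Union>i\<in>C. ?B i) \<in> sets lborel"
    by (simp, rule borel_open, rule open_UN, simp)
  have meas: "U - (\<Union>i\<in>C. ?B i) \<in> sets lborel"
    by (rule sets.Diff[OF _ cover]) (simp add: U)
  have "emeasure lebesgue (U - (\<Union>i\<in>C. ?B i)) = 0"
    using neg by (simp add: negligible_iff_null_sets null_sets_def)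
  then have null: "emeasure lborel (U - (\<Union>i\<in>C. ?B i)) = 0"
    using meas by simp
  have "emeasure lborel U \<le> emeasure lborel ((\<Union>i\<in>C. ?B i) \<union> (U - (\<Union>i\<in>C. ?B i)))"
    by (rule emeasure_mono[OF _ sets.Un[OF cover meas]]) blast
  also have "\<dots> \<le> emeasure lborel (\<Union>i\<in>C. ?B i) + emeasure lborel (U - (\<Union>i\<in>C. ?B i))"
    by (rule emeasure_subadditive[OF cover meas])
  also have "\<dots> = emeasure lborel (\<Union>i\<in>C. ?B i)"
    using null by simp
  also have "\<dots> = (\<integral>\<^sup>+i. emeasure lborel (?B i) \<partial>count_space C)"
    using C fam by (intro emeasure_UN_countable) auto
  also have "\<dots> = (\<integral>\<^sup>+i. emeasure lborel (R -` ?B i) \<partial>count_space C)"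
    unfolding ball by (intro nn_integral_cong shift)
  also have "\<dots> = emeasure lborel (\<Union>i\<in>C. R -` ?B i)"
  proof (rule emeasure_UN_countable[symmetric])
    show "disjoint_family_on (\<lambda>i. R -` ?B i) C"
      using fam unfolding disjoint_family_on_def vimage_Int[symmetric] by simp
  qed (use C in \<open>auto simp: ball\<close>)
  also have "\<dots> \<le> emeasure lborel (R -` U)"
  proof (rule emeasure_mono)
    show "(\<Union>i\<in>C. R -` ?B i) \<subseteq> R -` U"
      using C by (fastforce simp: K_def)
    have "continuous_on UNIV R"
      using lin by (simp add: linear_continuous_on linear_conv_bounded_linear)
    then show "R -` U \<in> sets lborel"
      using U by (auto intro!: borel_open open_vimage)
  qed
  finally show ?thesis .
qed

text \<open>The inequality just proved, applied to \<open>R\<close> and to its inverse, is an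
  equality on boxes, and boxes determine Lebesgue measure.\<close>

lemma lborel_distr_orthogonal:
  fixes R :: "'a::euclidean_space \<Rightarrow> 'a"
  assumes R: "orthogonal_transformation R"
  shows "distr lborel borel R = lborel"
proof (rule lborel_eqI[symmetric])
  have cont: "continuous_on UNIV R"
    using R by (simp add: orthogonal_transformation_def linear_continuous_on linear_conv_bounded_linear)
  then have [measurable]: "R \<in> borel \<rightarrow>\<^sub>M borel"
    by (rule borel_measurable_continuous_onI)
  fix l u :: 'a
  assume le: "\<And>b. b \<in> Basis \<Longrightarrow> l \<bullet> b \<le> u \<bullet> b"
  have inv: "orthogonal_transformation (inv R)" and bij: "bij R"
    using R by (auto simp: orthogonal_transformation_inv orthogonal_transformation_bij)
  have op: "open (R -` box l u)"
    using cont by (simp add: open_vimage open_box)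
  have "inv R -` (R -` box l u) = box l u"
    using bij by (simp add: vimage_comp[symmetric] o_def bij_is_surj surj_f_inv_f set_eq_iff)
  then have "emeasure lborel (R -` box l u) = emeasure lborel (box l u)"
    using emeasure_lborel_le_vimage_orthogonal[OF R open_box, of l u]
      emeasure_lborel_le_vimage_orthogonal[OF inv op] by simp
  then show "emeasure (distr lborel borel R) (box l u) = (\<Prod>b\<in>Basis. (u - l) \<bullet> b)"
    using le by (simp add: emeasure_distr)
qed simp

text \<open>An orthogonal map preserves the punctured ball and commutes with the radial projection
  onto the sphere, so invariance of Lebesgue measure passes to the sphere.\<close>

lemma sphere_integral_orthogonal:
  fixes R :: "real^'n \<Rightarrow> real^'n"
  assumes R: "orthogonal_transformation R" and h: "continuous_on (sphere 0 1) h"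
  shows "sphere_integral (\<lambda>x. h (R x)) = sphere_integral h"
proof -
  have cont: "continuous_on UNIV R"
    using R by (simp add: orthogonal_transformation_def linear_continuous_on linear_conv_bounded_linear)
  then have [measurable]: "R \<in> lborel \<rightarrow>\<^sub>M borel"
    using borel_measurable_continuous_onI by auto
  let ?U = "\<lambda>x::real^'n. indicator (ball 0 1 - {0}) x *\<^sub>R h (x /\<^sub>R norm x)"
  have "(\<integral>x. ?U x \<partial>lborel) = (\<integral>x. ?U x \<partial>distr lborel borel R)"
    by (simp add: lborel_distr_orthogonal[OF R])
  also have "\<dots> = (\<integral>x. ?U (R x) \<partial>lborel)"
    using borel_measurable_normalized[OF h] by (intro integral_distr) auto
  also have "\<dots> = (\<integral>x. indicator (ball 0 1 - {0}) x *\<^sub>R h (R (x /\<^sub>R norm x)) \<partial>lborel)"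
  proof (intro Bochner_Integration.integral_cong refl)
    fix x
    have n: "norm (R x) = norm x" and s: "R (x /\<^sub>R norm x) = R x /\<^sub>R norm x"
      using R by (simp_all add: orthogonal_transformation linear_scale)
    have "R x = 0 \<longleftrightarrow> x = 0"
      using n by (metis norm_eq_zero)
    with n s show "?U (R x) = indicator (ball 0 1 - {0}) x *\<^sub>R h (R (x /\<^sub>R norm x))"
      by (simp add: indicator_def)
  qed
  finally show ?thesis
    by (simp add: sphere_integral_punctured)
qed

subsection \<open>Smooth functions\<close>

lemma partial_has_vector_derivative:
  assumes "(\<lambda>t. g (x + t *\<^sub>R axis i 1)) differentiable (at 0)"
  shows "((\<lambda>t. g (x + t *\<^sub>R axis i 1)) has_vector_derivative partial i g x) (at 0)"
  using assms unfolding partial_def by (simp add: vector_derivative_works)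

lemma partial_eqI:
  "((\<lambda>t. g (x + t *\<^sub>R axis i 1)) has_vector_derivative D) (at 0) \<Longrightarrow> partial i g x = D"
  unfolding partial_def by (rule vector_derivative_at)

lemma line_in_open:
  fixes x v :: "'a::real_normed_vector"
  assumes "open G" "x \<in> G"
  shows "eventually (\<lambda>t. x + t *\<^sub>R v \<in> G) (nhds (0::real))"
proof -
  have "((\<lambda>t::real. x + t *\<^sub>R v) \<longlongrightarrow> x + 0 *\<^sub>R v) (nhds 0)"
    by (intro tendsto_intros) (simp add: filterlim_ident)
  then show ?thesis
    using assms by (intro topological_tendstoD) auto
qed

lemma has_vector_derivative_cong_open:
  fixes x v :: "'a::real_normed_vector" and g h :: "'a \<Rightarrow> 'b::real_normed_vector"
  assumes "open G" "x \<in> G" "\<And>y. y \<in> G \<Longrightarrow> g y = h y"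
  shows "((\<lambda>t. g (x + t *\<^sub>R v)) has_vector_derivative D) (at 0) \<longleftrightarrow>
    ((\<lambda>t. h (x + t *\<^sub>R v)) has_vector_derivative D) (at 0)"
proof (rule has_vector_derivative_cong_ev)
  show "\<forall>\<^sub>F t in nhds 0. t \<in> UNIV \<longrightarrow> g (x + t *\<^sub>R v) = h (x + t *\<^sub>R v)"
    using line_in_open[OF assms(1,2), of v] by eventually_elim (simp add: assms(3))
qed (use assms in auto)

lemma pderivs_append: "pderivs (is @ js) g = pderivs is (pderivs js g)"
  by (induction "is") auto

lemma smooth_on_pderivs: "smooth_on G g \<Longrightarrow> smooth_on G (pderivs js g)"
  unfolding smooth_on_def by (metis pderivs_append)

lemma smooth_on_partial: "smooth_on G g \<Longrightarrow> smooth_on G (partial i g)"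
  using smooth_on_pderivs[of G g "[i]"] by simp

lemma smooth_on_continuous: "smooth_on G g \<Longrightarrow> continuous_on G g"
  unfolding smooth_on_def by (metis pderivs.simps(1))

lemma smooth_on_has_partial:
  assumes "smooth_on G g" "x \<in> G"
  shows "((\<lambda>t. g (x + t *\<^sub>R axis i 1)) has_vector_derivative partial i g x) (at 0)"
  using assms unfolding smooth_on_def
  by (intro partial_has_vector_derivative) (metis pderivs.simps(1))

text \<open>Iterated partials of the Laplacian are sums of iterated partials of \<open>g\<close>.
  Outside \<open>G\<close> nothing is known about differentiability, so this identity holds on
  \<open>G\<close> only; the induction passes from one partial to the next because \<open>G\<close>
  is open.\<close>

lemma smooth_on_laplacian:
  assumes "open G" "smooth_on G g"
  shows "smooth_on G (laplacian g)"
proof -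
  have D: "((\<lambda>t. \<Sum>j\<in>UNIV. pderivs (is @ [j, j]) g (x + t *\<^sub>R axis i 1)) has_vector_derivative
      (\<Sum>j\<in>UNIV. pderivs (i # is @ [j, j]) g x)) (at 0)" if "x \<in> G" for "is" i x
    using smooth_on_has_partial[OF smooth_on_pderivs[OF assms(2)] that]
    by (intro has_vector_derivative_sum) (metis append_Cons pderivs.simps(2))
  have eq: "x \<in> G \<Longrightarrow> pderivs is (laplacian g) x = (\<Sum>j\<in>UNIV. pderivs (is @ [j, j]) g x)" for "is" x
  proof (induction "is" arbitrary: x)
    case Nil
    then show ?case by (simp add: laplacian_def)
  next
    case (Cons i "is")
    have "((\<lambda>t. pderivs is (laplacian g) (x + t *\<^sub>R axis i 1)) has_vector_derivative
        (\<Sum>j\<in>UNIV. pderivs (i # is @ [j, j]) g x)) (at 0)"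
      using D[OF Cons.prems]
      by (subst has_vector_derivative_cong_open[OF assms(1) Cons.prems Cons.IH])
    then show ?case
      by (simp add: partial_eqI)
  qed
  show ?thesis
    unfolding smooth_on_def
  proof (intro conjI allI ballI)
    fix "is"
    have "continuous_on G (\<lambda>x. \<Sum>j\<in>UNIV. pderivs (is @ [j, j]) g x)"
      using assms(2) unfolding smooth_on_def by (intro continuous_on_sum) auto
    then show "continuous_on G (pderivs is (laplacian g))"
      by (rule continuous_on_eq) (simp add: eq)
  next
    fix "is" i x assume x: "x \<in> G"
    have "((\<lambda>t. pderivs is (laplacian g) (x + t *\<^sub>R axis i 1)) has_vector_derivative
        (\<Sum>j\<in>UNIV. pderivs (i # is @ [j, j]) g x)) (at 0)"
      using D[OF x]
      by (subst has_vector_derivative_cong_open[OF assms(1) x eq])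
    then show "(\<lambda>t. pderivs is (laplacian g) (x + t *\<^sub>R axis i 1)) differentiable (at 0)"
      by (rule differentiableI_vector)
  qed
qed

lemma smooth_on_laplacian_funpow:
  "open G \<Longrightarrow> smooth_on G g \<Longrightarrow> smooth_on G ((laplacian ^^ p) g)"
  by (induction p) (auto intro: smooth_on_laplacian)

section \<open>Total differentiability from continuous partial derivatives\<close>

definition coord_part :: "'n set \<Rightarrow> real^'n \<Rightarrow> real^'n" where
  "coord_part I h = (\<chi> i. if i \<in> I then h $ i else 0)"

text \<open>\<open>coord_part\<close> gives the corners of a staircase path from x to x + h that
  adds one coordinate at a time. The bound keeps the whole path within distance |h| of x.\<close>

lemma norm_coord_part_add_le:
  fixes h :: "real^'n::finite"
  assumes "j \<notin> I" "\<bar>s\<bar> \<le> \<bar>h $ j\<bar>"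
  shows "norm (coord_part I h + s *\<^sub>R axis j 1) \<le> norm h"
proof (rule norm_le_componentwise_cart)
  fix i
  show "norm ((coord_part I h + s *\<^sub>R axis j 1) $ i) \<le> norm (h $ i)"
    using assms by (auto simp: coord_part_def axis_def)
qed

text \<open>Induction over the edges of the staircase: the new edge costs \<open>e/2\<close> by the
  mean value inequality and continuity of its partial derivative, the earlier edges cost
  \<open>e/2\<close> by the induction hypothesis, which is therefore general in
  \<open>e\<close>.\<close>

lemma partials_little_o:
  fixes g :: "real^'n \<Rightarrow> complex"
  assumes G: "open G" "x \<in> G"
    and deriv: "\<And>i y. y \<in> G \<Longrightarrow> ((\<lambda>t. g (y + t *\<^sub>R axis i 1)) has_vector_derivative g' i y) (at 0)"
    and cont: "\<And>i. continuous_on G (g' i)"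
    and "finite I" "0 < e"
  shows "\<exists>d>0. \<forall>h. norm h < d \<longrightarrow>
    norm (g (x + coord_part I h) - g x - (\<Sum>i\<in>I. h $ i *\<^sub>R g' i x)) \<le> e * norm h"
  using \<open>finite I\<close> \<open>0 < e\<close>
proof (induction I arbitrary: e rule: finite_induct)
  case empty
  have "coord_part {} h = 0" for h :: "real^'n"
    by (simp add: coord_part_def vec_eq_iff)
  then show ?case
    using empty by (intro exI[of _ 1]) simp
next
  case (insert j I)
  obtain d1 where d1: "d1 > 0" "\<And>h. norm h < d1 \<Longrightarrow>
      norm (g (x + coord_part I h) - g x - (\<Sum>i\<in>I. h $ i *\<^sub>R g' i x)) \<le> e/2 * norm h"
    using insert.IH[of "e/2"] insert.prems by auto
  obtain d2 where d2: "d2 > 0" "ball x d2 \<subseteq> G"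
    using G openE by blast
  obtain d3 where d3: "d3 > 0" "\<And>y. y \<in> G \<Longrightarrow> dist y x < d3 \<Longrightarrow> dist (g' j y) (g' j x) < e/2"
    using cont[of j] G insert.prems unfolding continuous_on_iff by (meson half_gt_zero)
  define d where "d = min d1 (min d2 d3)"
  show ?case
  proof (intro exI conjI allI impI)
    show "d > 0" using d1 d2 d3 by (simp add: d_def)
    fix h :: "real^'n" assume h: "norm h < d"
    let ?y = "\<lambda>s. x + coord_part I h + s *\<^sub>R axis j 1"
    have near: "?y s \<in> G" "dist (?y s) x < d3" if "\<bar>s\<bar> \<le> \<bar>h $ j\<bar>" for s
    proof -
      have "dist (?y s) x < d"
        using norm_coord_part_add_le[OF insert.hyps(2) that] h by (simp add: dist_norm add.assoc)
      then show "?y s \<in> G" "dist (?y s) x < d3"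
        using d2 by (auto simp: d_def dist_commute subset_iff)
    qed
    have seg: "\<bar>s\<bar> \<le> \<bar>h $ j\<bar>" if "s \<in> closed_segment 0 (h $ j)" for s
      using that by (auto simp: closed_segment_eq_real_ivl split: if_splits)
    have "norm (g (?y (h $ j)) - g (?y 0) - (h $ j - 0) *\<^sub>R g' j x) \<le> norm (h $ j - 0) * (e/2)"
    proof -
      \<comment> \<open>With the linear part subtracted, the derivative along the edge is
        \<open>g' j (?y s) - g' j x\<close>, which is at most \<open>e/2\<close> by the choice of
        \<open>d3\<close>.\<close>
      let ?F = "\<lambda>s. g (?y s) - s *\<^sub>R g' j x"
      have "norm (?F (h $ j) - ?F 0) \<le> (e/2) * norm (h $ j - 0)"
      proof (rule differentiable_bound[where S="closed_segment 0 (h $ j)" and f'="\<lambda>s t. t *\<^sub>R (g' j (?y s) - g' j x)"])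
        fix s assume s: "s \<in> closed_segment 0 (h $ j)"
        have "((\<lambda>t. g (?y s + t *\<^sub>R axis j 1)) has_vector_derivative g' j (?y s)) (at (s - s))"
          using deriv near seg[OF s] by simp
        moreover have "((\<lambda>t. t - s) has_vector_derivative 1) (at s)"
          by (auto intro!: derivative_eq_intros)
        ultimately have "((\<lambda>t. g (?y s + (t - s) *\<^sub>R axis j 1)) has_vector_derivative g' j (?y s)) (at s)"
          using vector_diff_chain_at[of "\<lambda>t. t - s" 1 s "\<lambda>t. g (?y s + t *\<^sub>R axis j 1)"] by (simp add: o_def)
        then have "((\<lambda>t. g (?y t)) has_vector_derivative g' j (?y s)) (at s)"
          by (simp add: algebra_simps)
        then have "(?F has_vector_derivative g' j (?y s) - g' j x) (at s)"
          by (auto intro!: derivative_eq_intros)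
        then show "(?F has_derivative (\<lambda>t. t *\<^sub>R (g' j (?y s) - g' j x))) (at s within closed_segment 0 (h $ j))"
          by (auto simp: has_vector_derivative_def intro: has_derivative_at_withinI)
        show "onorm (\<lambda>t. t *\<^sub>R (g' j (?y s) - g' j x)) \<le> e/2"
          using d3(2)[OF near[OF seg[OF s]]]
          by (simp add: onorm_scaleR_left onorm_id bounded_linear_ident dist_norm)
      qed auto
      then show ?thesis by (simp add: algebra_simps)
    qed
    also have "\<dots> \<le> e/2 * norm h"
      using component_le_norm_cart[of h j] insert.prems by (simp add: mult.commute)
    finally have 1: "norm (g (?y (h $ j)) - g (?y 0) - h $ j *\<^sub>R g' j x) \<le> e/2 * norm h"
      by simp
    have 2: "norm (g (x + coord_part I h) - g x - (\<Sum>i\<in>I. h $ i *\<^sub>R g' i x)) \<le> e/2 * norm h"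
      using d1 h by (simp add: d_def)
    have "coord_part (insert j I) h = coord_part I h + (h $ j) *\<^sub>R axis j 1"
      using insert.hyps by (auto simp: coord_part_def vec_eq_iff axis_def)
    then have "g (x + coord_part (insert j I) h) - g x - (\<Sum>i\<in>insert j I. h $ i *\<^sub>R g' i x) =
        (g (?y (h $ j)) - g (?y 0) - h $ j *\<^sub>R g' j x) + (g (x + coord_part I h) - g x - (\<Sum>i\<in>I. h $ i *\<^sub>R g' i x))"
      using insert.hyps by (simp add: algebra_simps)
    note eq = this
    show "norm (g (x + coord_part (insert j I) h) - g x - (\<Sum>i\<in>insert j I. h $ i *\<^sub>R g' i x)) \<le> e * norm h"
      using norm_triangle_mono[OF 1 2] unfolding eq by simp
  qed
qed

lemma smooth_on_has_derivative:
  fixes g :: "real^'n \<Rightarrow> complex"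
  assumes "open G" "smooth_on G g" "x \<in> G"
  shows "(g has_derivative (\<lambda>h. \<Sum>i\<in>UNIV. h $ i *\<^sub>R partial i g x)) (at x)"
  unfolding has_derivative_at_alt
proof (intro conjI allI impI)
  show "bounded_linear (\<lambda>h. \<Sum>i\<in>UNIV. h $ i *\<^sub>R partial i g x)"
    by (intro bounded_linear_sum bounded_linear_scaleR_const bounded_linear_vec_nth)
  fix e :: real assume e: "e > 0"
  have "\<exists>d>0. \<forall>h. norm h < d \<longrightarrow>
    norm (g (x + coord_part UNIV h) - g x - (\<Sum>i\<in>UNIV. h $ i *\<^sub>R partial i g x)) \<le> e * norm h"
    using assms e smooth_on_has_partial[OF assms(2)] smooth_on_continuous[OF smooth_on_partial[OF assms(2)]]
    by (intro partials_little_o[of G]) auto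
  then obtain d where d: "d > 0" "\<And>h. norm h < d \<Longrightarrow>
    norm (g (x + h) - g x - (\<Sum>i\<in>UNIV. h $ i *\<^sub>R partial i g x)) \<le> e * norm h"
    by (auto simp: coord_part_def)
  show "\<exists>d>0. \<forall>y. norm (y - x) < d \<longrightarrow>
      norm (g y - g x - (\<Sum>i\<in>UNIV. (y - x) $ i *\<^sub>R partial i g x)) \<le> e * norm (y - x)"
    using d(1) d(2)[of "_ - x"] by (intro exI[of _ d]) simp
qed

subsection \<open>Rotation fields and solid harmonics\<close>

text \<open>Polynomials in the coordinates with the degree forgotten: the class is closed under
  partial derivatives, so smoothness of spherical harmonics follows by rule induction.\<close>

inductive cpoly :: "(real^'n \<Rightarrow> complex) \<Rightarrow> bool" where
  const: "cpoly (\<lambda>x. c)"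
| coord: "cpoly (\<lambda>x. complex_of_real (x $ i))"
| add: "cpoly p \<Longrightarrow> cpoly q \<Longrightarrow> cpoly (\<lambda>x. p x + q x)"
| mult: "cpoly p \<Longrightarrow> cpoly q \<Longrightarrow> cpoly (\<lambda>x. p x * q x)"

lemma cpoly_sum: "(\<And>i. i \<in> A \<Longrightarrow> cpoly (p i)) \<Longrightarrow> cpoly (\<lambda>x. \<Sum>i\<in>A. p i x)"
  by (induction A rule: infinite_finite_induct) (auto intro: cpoly.intros)

lemma cpoly_prod: "(\<And>i. i \<in> A \<Longrightarrow> cpoly (p i)) \<Longrightarrow> cpoly (\<lambda>x. \<Prod>i\<in>A. p i x)"
  by (induction A rule: infinite_finite_induct) (auto intro: cpoly.intros)

lemma cpoly_power: "cpoly p \<Longrightarrow> cpoly (\<lambda>x. p x ^ n)"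
  by (induction n) (auto intro: cpoly.intros)

lemma cpoly_hom_poly: "hom_poly k p \<Longrightarrow> cpoly p"
  unfolding hom_poly_def by (auto intro!: cpoly_sum cpoly_prod cpoly_power cpoly.intros)

lemma cpoly_continuous: "cpoly p \<Longrightarrow> continuous_on S p"
  by (induction rule: cpoly.induct) (auto intro!: continuous_intros)

lemma cpoly_derivative:
  fixes p :: "real^'n \<Rightarrow> complex"
  shows "cpoly p \<Longrightarrow> \<exists>q. cpoly q \<and> (\<forall>x. ((\<lambda>t. p (x + t *\<^sub>R axis i 1)) has_vector_derivative q x) (at 0))"
proof (induction rule: cpoly.induct)
  case (const c)
  then show ?case by (intro exI[of _ "\<lambda>x. 0"]) (auto intro: cpoly.intros)
next
  case (coord j)
  have "((\<lambda>t. complex_of_real ((x + t *\<^sub>R axis i 1) $ j)) has_vector_derivative of_real (axis i 1 $ j)) (at 0)" for x :: "real^'n"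
    by (auto intro!: derivative_eq_intros)
  then show ?case
    by (intro exI[of _ "\<lambda>x. complex_of_real (axis i 1 $ j)"] conjI cpoly.const) blast
next
  case (add p q)
  then obtain p' q' where
    "cpoly p'" "cpoly q'" "\<And>x. ((\<lambda>t. p (x + t *\<^sub>R axis i 1)) has_vector_derivative p' x) (at 0)"
    "\<And>x. ((\<lambda>t. q (x + t *\<^sub>R axis i 1)) has_vector_derivative q' x) (at 0)"
    by blast
  then show ?case
    by (intro exI[of _ "\<lambda>x. p' x + q' x"]) (auto intro!: cpoly.add has_vector_derivative_add)
next
  case (mult p q)
  then obtain p' q' where
    *: "cpoly p'" "cpoly q'" "\<And>x. ((\<lambda>t. p (x + t *\<^sub>R axis i 1)) has_vector_derivative p' x) (at 0)"
    "\<And>x. ((\<lambda>t. q (x + t *\<^sub>R axis i 1)) has_vector_derivative q' x) (at 0)"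
    by blast
  have "((\<lambda>t. p (x + t *\<^sub>R axis i 1) * q (x + t *\<^sub>R axis i 1)) has_vector_derivative p x * q' x + p' x * q x) (at 0)" for x
    using has_vector_derivative_mult[OF *(3,4), of x x] by simp
  then show ?case
    using * mult.hyps by (intro exI[of _ "\<lambda>x. p x * q' x + p' x * q x"]) (auto intro!: cpoly.intros)
qed

lemma cpoly_partial: "cpoly p \<Longrightarrow> cpoly (partial i p)"
  using cpoly_derivative[of p i] partial_eqI[of p _ i] by (metis ext)

lemma cpoly_pderivs: "cpoly p \<Longrightarrow> cpoly (pderivs is p)"
  by (induction "is") (auto intro: cpoly_partial)

lemma smooth_on_cpoly: "cpoly p \<Longrightarrow> smooth_on S p"
  unfolding smooth_on_def
  using cpoly_pderivs cpoly_continuous cpoly_derivative differentiableI_vector by metis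

lemma hom_poly_scaleR:
  assumes "hom_poly k p"
  shows "p (t *\<^sub>R x) = complex_of_real (t ^ k) * p x"
proof -
  obtain c where p: "p = (\<lambda>x. \<Sum>\<alpha>\<in>{\<alpha>. sum \<alpha> UNIV = k}. c \<alpha> * (\<Prod>i\<in>UNIV. complex_of_real (x $ i) ^ \<alpha> i))"
    using assms unfolding hom_poly_def by blast
  have "(\<Prod>i\<in>UNIV. complex_of_real ((t *\<^sub>R x) $ i) ^ \<alpha> i)
      = complex_of_real (t ^ k) * (\<Prod>i\<in>UNIV. complex_of_real (x $ i) ^ \<alpha> i)" if "sum \<alpha> UNIV = k" for \<alpha>
    using that by (simp add: power_mult_distrib prod.distrib flip: power_sum)
  then show ?thesis
    unfolding p sum_distrib_left by (intro sum.cong) auto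
qed

section \<open>Second-order identities for the Euler and rotation fields\<close>

definition euler :: "(real^'n \<Rightarrow> complex) \<Rightarrow> real^'n \<Rightarrow> complex" where
  "euler g x = (\<Sum>i\<in>UNIV. x $ i *\<^sub>R partial i g x)"

text \<open>This is r^2 times the second radial derivative; with E the Euler field, E (E g) = E g +
  \<open>hess g\<close>.\<close>

definition hess :: "(real^'n \<Rightarrow> complex) \<Rightarrow> real^'n \<Rightarrow> complex" where
  "hess g x = (\<Sum>i\<in>UNIV. \<Sum>j\<in>UNIV. (x $ i * x $ j) *\<^sub>R partial j (partial i g) x)"

definition rotgen :: "'n::finite \<Rightarrow> 'n \<Rightarrow> real^'n \<Rightarrow> real^'n" where
  "rotgen i j x = x $ i *\<^sub>R axis j 1 - x $ j *\<^sub>R axis i 1"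

definition rot :: "'n::finite \<Rightarrow> 'n \<Rightarrow> (real^'n \<Rightarrow> complex) \<Rightarrow> real^'n \<Rightarrow> complex" where
  "rot i j g x = x $ i *\<^sub>R partial j g x - x $ j *\<^sub>R partial i g x"

text \<open>The derivative of \<^term>\<open>rot i j g\<close> along \<^term>\<open>rotgen i j\<close>, written so that no symmetry of the
  mixed partial derivatives is needed.\<close>
definition rot2 :: "'n::finite \<Rightarrow> 'n \<Rightarrow> (real^'n \<Rightarrow> complex) \<Rightarrow> real^'n \<Rightarrow> complex" where
  "rot2 i j g x = x $ i *\<^sub>R rot i j (partial j g) x - x $ j *\<^sub>R rot i j (partial i g) x
     + (rotgen i j x $ i) *\<^sub>R partial j g x - (rotgen i j x $ j) *\<^sub>R partial i g x"

text \<open>Evaluates the total derivative from \<open>smooth_on_has_derivative\<close> in the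
  direction of the rotation field. For i = j both sides vanish.\<close>

lemma sum_rotgen:
  "(\<Sum>m\<in>UNIV. rotgen i j x $ m *\<^sub>R F m) = x $ i *\<^sub>R F j - x $ j *\<^sub>R (F i :: 'a::real_vector)"
proof -
  have "(\<Sum>m\<in>UNIV. (if m = j then x $ i *\<^sub>R F m else 0)) = x $ i *\<^sub>R F j"
       "(\<Sum>m\<in>UNIV. (if m = i then x $ j *\<^sub>R F m else 0)) = x $ j *\<^sub>R F i"
    by (simp_all add: sum.delta)
  moreover have "rotgen i j x $ m *\<^sub>R F m = (if m = j then x $ i *\<^sub>R F m else 0) - (if m = i then x $ j *\<^sub>R F m else 0)" for m
    by (auto simp: rotgen_def axis_def scaleR_diff_left)
  ultimately show ?thesis
    by (simp only: sum_subtractf)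
qed

context
  fixes G :: "(real^'n) set" and g :: "real^'n \<Rightarrow> complex"
  assumes G: "open G" and g: "smooth_on G g"
begin

lemma has_derivative_rot:
  assumes "x \<in> G"
  shows "\<exists>D. (rot i j g has_derivative D) (at x) \<and> D (rotgen i j x) = rot2 i j g x"
proof -
  note pd = smooth_on_has_derivative[OF G smooth_on_partial[OF g] assms]
  have c: "((\<lambda>x. x $ i) has_derivative (\<lambda>h. h $ i)) (at x)" for i
    by (intro bounded_linear_imp_has_derivative bounded_linear_vec_nth)
  have "((\<lambda>x. x $ i *\<^sub>R partial j g x - x $ j *\<^sub>R partial i g x) has_derivative
     (\<lambda>h. (x $ i *\<^sub>R (\<Sum>m\<in>UNIV. h $ m *\<^sub>R partial m (partial j g) x) + h $ i *\<^sub>R partial j g x)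
        - (x $ j *\<^sub>R (\<Sum>m\<in>UNIV. h $ m *\<^sub>R partial m (partial i g) x) + h $ j *\<^sub>R partial i g x))) (at x)"
    by (intro has_derivative_diff has_derivative_scaleR c pd)
  then show ?thesis
    unfolding rot_def[abs_def]
    by (intro exI conjI, assumption) (simp add: sum_rotgen rot2_def rot_def)
qed

text \<open>The curve exp(t) x has velocity equal to its position, so differentiating in the
  logarithmic radius is applying the Euler field.\<close>

lemma has_vector_derivative_along_euler:
  assumes x: "exp t *\<^sub>R x \<in> G"
  shows "((\<lambda>t. g (exp t *\<^sub>R x)) has_vector_derivative euler g (exp t *\<^sub>R x)) (at t)" (is ?A)
    and "((\<lambda>t. euler g (exp t *\<^sub>R x)) has_vector_derivative
      euler g (exp t *\<^sub>R x) + hess g (exp t *\<^sub>R x)) (at t)" (is ?B)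
proof -
  let ?y = "exp t *\<^sub>R x"
  have curve: "((\<lambda>t. exp t *\<^sub>R x) has_vector_derivative ?y) (at t)"
    by (auto intro!: derivative_eq_intros)
  have chain: "((\<lambda>t. f (exp t *\<^sub>R x)) has_vector_derivative D ?y) (at t)"
    if "(f has_derivative D) (at ?y)" for f :: "real^'n \<Rightarrow> complex" and D
    using vector_derivative_diff_chain_within[OF curve has_derivative_at_withinI[OF that]] by (simp add: o_def)
  show ?A
    using chain[OF smooth_on_has_derivative[OF G g x]] by (simp add: euler_def)
  have c: "((\<lambda>x. x $ i) has_derivative (\<lambda>h. h $ i)) (at ?y)" for i
    by (intro bounded_linear_imp_has_derivative bounded_linear_vec_nth)
  have "((\<lambda>x. \<Sum>i\<in>UNIV. x $ i *\<^sub>R partial i g x) has_derivative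
     (\<lambda>h. \<Sum>i\<in>UNIV. ?y $ i *\<^sub>R (\<Sum>j\<in>UNIV. h $ j *\<^sub>R partial j (partial i g) ?y) + h $ i *\<^sub>R partial i g ?y)) (at ?y)"
    by (intro has_derivative_sum has_derivative_scaleR c smooth_on_has_derivative[OF G smooth_on_partial[OF g] x])
  from chain[OF this] show ?B
    unfolding euler_def[abs_def] hess_def by (simp add: sum.distrib scaleR_sum_right add.commute)
qed

lemma continuous_on_operators:
  shows "continuous_on G (euler g)" "continuous_on G (hess g)"
    and "continuous_on G (rot i j g)" "continuous_on G (rot2 i j g)"
proof -
  note c = smooth_on_continuous[OF smooth_on_partial[OF g]]
    smooth_on_continuous[OF smooth_on_partial[OF smooth_on_partial[OF g]]]
  show "continuous_on G (euler g)" "continuous_on G (hess g)"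
    "continuous_on G (rot i j g)" "continuous_on G (rot2 i j g)"
    unfolding euler_def[abs_def] hess_def[abs_def] rot_def[abs_def] rot2_def[abs_def] rotgen_def
    by (auto intro!: continuous_intros c)
qed

end

text \<open>The factor 2 arises because ordered pairs count every coordinate plane twice. Of the
  four second-order double sums, two equal |x|^2 times the Laplacian and two equal
  \<open>hess\<close>, after renaming indices. The first-order terms give -2d E, and the diagonal i
  = j returns 2 E.\<close>

lemma laplacian_rot_identity:
  fixes g :: "real^'n \<Rightarrow> complex"
  shows "(\<Sum>i\<in>UNIV. \<Sum>j\<in>UNIV. rot2 i j g x)
    = 2 * (of_real ((norm x)\<^sup>2) * laplacian g x - of_real (real CARD('n) - 1) * euler g x - hess g x)"
proof -
  let ?p = "\<lambda>i. partial i g x" and ?q = "\<lambda>i j. partial i (partial j g) x"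
  let ?c = "\<lambda>i. complex_of_real (x $ i)"
  have g: "rotgen i j x $ i = (if i = j then x $ i else 0) - x $ j"
    "rotgen i j x $ j = x $ i - (if i = j then x $ j else 0)" for i j
    by (auto simp: rotgen_def axis_def)
  have r: "rot2 i j g x = ?c i * ?c i * ?q j j + ?c j * ?c j * ?q i i
      - ?c i * ?c j * ?q i j - ?c j * ?c i * ?q j i - ?c i * ?p i - ?c j * ?p j
      + (if i = j then 2 * (?c i * ?p i) else 0)" for i j
    unfolding rot2_def rot_def g by (simp add: scaleR_conv_of_real algebra_simps)
  have n: "of_real ((norm x)\<^sup>2) = (\<Sum>i\<in>UNIV. ?c i * ?c i)"
    by (simp add: norm_vec_def L2_set_def sum_nonneg real_sqrt_pow2 power2_eq_square)
  have e: "euler g x = (\<Sum>i\<in>UNIV. ?c i * ?p i)"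
    by (simp add: euler_def scaleR_conv_of_real)
  have l: "of_real ((norm x)\<^sup>2) * laplacian g x = (\<Sum>i\<in>UNIV. \<Sum>j\<in>UNIV. ?c i * ?c i * ?q j j)"
    unfolding n laplacian_def by (simp add: sum_product)
  have l': "of_real ((norm x)\<^sup>2) * laplacian g x = (\<Sum>i\<in>UNIV. \<Sum>j\<in>UNIV. ?c j * ?c j * ?q i i)"
    unfolding l by (rule sum.swap)
  have h: "hess g x = (\<Sum>i\<in>UNIV. \<Sum>j\<in>UNIV. ?c j * ?c i * ?q j i)"
    by (simp add: hess_def scaleR_conv_of_real mult.commute)
  have h': "hess g x = (\<Sum>i\<in>UNIV. \<Sum>j\<in>UNIV. ?c i * ?c j * ?q i j)"
    unfolding h by (rule sum.swap)
  have s1: "(\<Sum>i\<in>UNIV. \<Sum>j\<in>(UNIV::'n set). ?c i * ?p i) = of_nat CARD('n) * euler g x"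
    unfolding e by (simp add: sum_distrib_left)
  have s2: "(\<Sum>i\<in>(UNIV::'n set). \<Sum>j\<in>UNIV. ?c j * ?p j) = of_nat CARD('n) * euler g x"
    unfolding e by simp
  have s3: "(\<Sum>i\<in>UNIV. \<Sum>j\<in>UNIV. if i = j then 2 * (?c i * ?p i) else 0) = 2 * euler g x"
    unfolding e by (simp add: sum_distrib_left)
  show ?thesis
    unfolding r sum.distrib sum_subtractf s1 s2 s3 l[symmetric] l'[symmetric] h[symmetric] h'[symmetric]
    by (simp add: algebra_simps)
qed

text \<open>Homogeneity gives E p = k p and hence \<open>hess p\<close> = k (k - 1) p. With
  vanishing Laplacian the identity above leaves -2 (k (k - 1) + (d - 1) k) p.\<close>

lemma harm_hom_poly_rot2:
  fixes p :: "real^'n \<Rightarrow> complex"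
  assumes "harm_hom_poly k p"
  shows "(\<Sum>i\<in>UNIV. \<Sum>j\<in>UNIV. rot2 i j p x) = - of_real (2 * real k * (real k + real CARD('n) - 2)) * p x"
proof -
  have hom: "hom_poly k p" and harm: "laplacian p x = 0"
    using assms by (auto simp: harm_hom_poly_def)
  have sm: "smooth_on UNIV p"
    using smooth_on_cpoly[OF cpoly_hom_poly[OF hom]] .
  have scale: "p (exp t *\<^sub>R x) = complex_of_real (exp (real k * t)) * p x" for t x
    by (simp add: hom_poly_scaleR[OF hom] exp_of_nat_mult)
  have d: "((\<lambda>t. complex_of_real (exp (real k * t)) * c) has_vector_derivative complex_of_real (real k * exp (real k * t)) * c) (at t)" for c t
    by (auto intro!: derivative_eq_intros has_vector_derivative_mult_left has_vector_derivative_of_real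
        simp flip: has_real_derivative_iff_has_vector_derivative)
  \<comment> \<open>Stated along the whole ray and not only at t = 0, so that it can be
    differentiated once more to obtain \<open>hess\<close>.\<close>
  have e: "euler p (exp t *\<^sub>R x) = complex_of_real (exp (real k * t)) * (of_nat k * p x)" for t x
    using vector_derivative_unique_at[OF has_vector_derivative_along_euler(1)[OF open_UNIV sm] d[of "p x" t, folded scale]]
    by (simp add: mult_ac)
  have "euler p x + hess p x = of_nat k * (of_nat k * p x)"
    using vector_derivative_unique_at[OF has_vector_derivative_along_euler(2)[OF open_UNIV sm, of 0 x] d[of "of_nat k * p x" 0, folded e]]
    by simp
  moreover have e0: "euler p x = of_nat k * p x"
    using e[of 0 x] by simp
  ultimately have h: "hess p x = of_nat k * (of_nat k * p x) - of_nat k * p x"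
    by (simp add: algebra_simps)
  show ?thesis
    unfolding laplacian_rot_identity harm h e0 by (simp add: algebra_simps)
qed

section \<open>The rotation flow in a coordinate plane and integration by parts\<close>

definition rotflow :: "'n::finite \<Rightarrow> 'n \<Rightarrow> real \<Rightarrow> real^'n \<Rightarrow> real^'n" where
  "rotflow i j t x = x + ((cos t - 1) * x $ i - sin t * x $ j) *\<^sub>R axis i 1
     + (sin t * x $ i + (cos t - 1) * x $ j) *\<^sub>R axis j 1"

lemma rotflow_zero [simp]: "rotflow i j 0 x = x"
  by (simp add: rotflow_def)

lemma orthogonal_transformation_rotflow:
  fixes i j :: "'n::finite"
  assumes "i \<noteq> j"
  shows "orthogonal_transformation (rotflow i j t)"
  unfolding orthogonal_transformation
proof (intro conjI allI)
  show "linear (rotflow i j t)"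
    by (intro linearI) (simp_all add: rotflow_def algebra_simps)
  fix x :: "real^'n"
  have sp: "(\<Sum>m\<in>UNIV. (y $ m)\<^sup>2) = (y $ i)\<^sup>2 + (y $ j)\<^sup>2 + (\<Sum>m\<in>UNIV - {i, j}. (y $ m)\<^sup>2)" for y :: "real^'n"
    using assms by (simp add: sum.remove[of UNIV i] sum.remove[of "UNIV - {i}" j] Diff_insert2[symmetric] insert_commute)
  have "(rotflow i j t x $ i)\<^sup>2 + (rotflow i j t x $ j)\<^sup>2
      = (cos t * x $ i - sin t * x $ j)\<^sup>2 + (sin t * x $ i + cos t * x $ j)\<^sup>2"
    using assms by (simp add: rotflow_def axis_def algebra_simps)
  also have "\<dots> = ((sin t)\<^sup>2 + (cos t)\<^sup>2) * ((x $ i)\<^sup>2 + (x $ j)\<^sup>2)"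
    by (simp add: power2_eq_square algebra_simps
        del: sin_cos_squared_add sin_cos_squared_add2 sin_cos_squared_add3)
  finally have "(rotflow i j t x $ i)\<^sup>2 + (rotflow i j t x $ j)\<^sup>2 = (x $ i)\<^sup>2 + (x $ j)\<^sup>2"
    by simp
  moreover have "(\<Sum>m\<in>UNIV - {i, j}. (rotflow i j t x $ m)\<^sup>2) = (\<Sum>m\<in>UNIV - {i, j}. (x $ m)\<^sup>2)"
    by (intro sum.cong) (auto simp: rotflow_def axis_def)
  ultimately have "(\<Sum>m\<in>UNIV. (rotflow i j t x $ m)\<^sup>2) = (\<Sum>m\<in>UNIV. (x $ m)\<^sup>2)"
    unfolding sp by simp
  then show "norm (rotflow i j t x) = norm x"
    by (simp add: norm_vec_def L2_set_def)
qed

lemma rotflow_has_vector_derivative: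
  assumes "i \<noteq> j"
  shows "((\<lambda>t. rotflow i j t x) has_vector_derivative rotgen i j (rotflow i j t x)) (at t)"
proof -
  have "((\<lambda>t. rotflow i j t x) has_vector_derivative
      (- sin t * x $ i - cos t * x $ j) *\<^sub>R axis i 1 + (cos t * x $ i - sin t * x $ j) *\<^sub>R axis j 1) (at t)"
    unfolding rotflow_def
    by (auto intro!: derivative_eq_intros simp: algebra_simps)
  moreover have "(- sin t * x $ i - cos t * x $ j) *\<^sub>R axis i 1 + (cos t * x $ i - sin t * x $ j) *\<^sub>R axis j 1
      = rotgen i j (rotflow i j t x)"
    using assms by (simp add: rotgen_def rotflow_def axis_def vec_eq_iff algebra_simps)
  ultimately show ?thesis by simp
qed

text \<open>The integral of u(R_t x) does not depend on t by rotation invariance; its derivative at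
  t = 0 is the integral of \<open>u'\<close>.\<close>

lemma sphere_integral_rot_derivative:
  fixes u :: "real^'n \<Rightarrow> complex"
  assumes ij: "i \<noteq> j"
    and deriv: "\<And>t x. norm x = 1 \<Longrightarrow>
      ((\<lambda>t. u (rotflow i j t x)) has_vector_derivative u' (rotflow i j t x)) (at t)"
    and u: "continuous_on (sphere 0 1) u" and u': "continuous_on (sphere 0 1) u'"
  shows "sphere_integral u' = 0"
proof -
  have ot: "orthogonal_transformation (rotflow i j t)" for t
    by (rule orthogonal_transformation_rotflow[OF ij])
  have nrm: "norm (rotflow i j t x) = norm x" for t x
    using ot by (simp add: orthogonal_transformation)
  have c: "continuous_on S (\<lambda>(t, x). rotflow i j t x)" for S
    unfolding rotflow_def case_prod_beta by (intro continuous_intros)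
  have "((\<lambda>t. sphere_integral (\<lambda>x. u (rotflow i j t x))) has_vector_derivative
      sphere_integral (\<lambda>x. u' (rotflow i j 0 x))) (at 0)"
  proof (rule sphere_integral_has_vector_derivative[where a="-1" and b=1])
    show "continuous_on (sphere 0 1) (\<lambda>x. u (rotflow i j t x))" for t
      by (rule continuous_on_compose2[OF u])
        (auto simp: nrm linear_continuous_on linear_conv_bounded_linear orthogonal_transformation_linear[OF ot]
          simp flip: linear_conv_bounded_linear)
    show "continuous_on ({-1..1} \<times> sphere 0 1) (\<lambda>(t, x). u' (rotflow i j t x))"
      unfolding case_prod_beta
      by (rule continuous_on_compose2[OF u' c[unfolded case_prod_beta]]) (auto simp: nrm)
  qed (auto intro: deriv)
  moreover have "sphere_integral (\<lambda>x. u (rotflow i j t x)) = sphere_integral u" for t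
    by (rule sphere_integral_orthogonal[OF ot u])
  ultimately have "((\<lambda>t::real. sphere_integral u) has_vector_derivative sphere_integral u') (at 0)"
    by simp
  then show ?thesis
    using vector_derivative_unique_at has_vector_derivative_const by blast
qed

subsection \<open>The differential equation of the spherical coefficients\<close>

lemma continuous_on_sphere_scaled:
  assumes "continuous_on G h" "\<And>x. norm x = 1 \<Longrightarrow> r *\<^sub>R x \<in> G"
  shows "continuous_on (sphere 0 1) (\<lambda>x. h (r *\<^sub>R x))"
  by (rule continuous_on_compose2[OF assms(1)]) (auto intro!: continuous_intros assms(2))

lemma has_vector_derivative_along_rotflow:
  fixes u :: "real^'n \<Rightarrow> complex"
  assumes "i \<noteq> j" and D: "(u has_derivative D) (at (r *\<^sub>R rotflow i j t x))"
  shows "((\<lambda>t. u (r *\<^sub>R rotflow i j t x)) has_vector_derivative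
    D (rotgen i j (r *\<^sub>R rotflow i j t x))) (at t)"
proof -
  have "((\<lambda>t. r *\<^sub>R rotflow i j t x) has_vector_derivative r *\<^sub>R rotgen i j (rotflow i j t x)) (at t)"
    using rotflow_has_vector_derivative[OF assms(1)]
    by (rule bounded_linear.has_vector_derivative[OF bounded_linear_scaleR_right])
  from vector_derivative_diff_chain_within[OF this has_derivative_at_withinI[OF D]] show ?thesis
    by (simp add: o_def rotgen_def scaleR_diff_right)
qed

text \<open>Two integrations by parts, for the products (L g) cnj Y and g cnj (L Y) with L =
  \<open>rot i j\<close>. Both produce the integral of (L g) cnj (L Y), which cancels. The dilation
  by \<open>r\<close> is harmless because the rotation field is linear. For i = j, where
  \<open>rotflow\<close> is not a rotation, both sides are zero.\<close>

lemma sphere_integral_rot2_adjoint: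
  fixes g Y :: "real^'n \<Rightarrow> complex"
  assumes G: "open G" and g: "smooth_on G g" and rG: "\<And>x. norm x = 1 \<Longrightarrow> r *\<^sub>R x \<in> G"
    and Y: "smooth_on UNIV Y"
  shows "sphere_integral (\<lambda>x. rot2 i j g (r *\<^sub>R x) * cnj (Y x)) =
    sphere_integral (\<lambda>x. g (r *\<^sub>R x) * cnj (rot2 i j Y x))"
proof (cases "i = j")
  case True
  then have "rot2 i j h x = 0" for h :: "real^'n \<Rightarrow> complex" and x
    by (simp add: rot2_def rot_def)
  then show ?thesis by simp
next
  case False
  have nrm: "norm (rotflow i j t x) = norm x" for t x
    using orthogonal_transformation_rotflow[OF False, of t] by (simp add: orthogonal_transformation)
  note cg = smooth_on_continuous[OF g] continuous_on_operators[OF G g]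
  note cY = smooth_on_continuous[OF Y] continuous_on_operators[OF open_UNIV Y]
  have cont: "continuous_on (sphere 0 1) (\<lambda>x. g (r *\<^sub>R x))"
    "continuous_on (sphere 0 1) (\<lambda>x. rot i j g (r *\<^sub>R x))"
    "continuous_on (sphere 0 1) (\<lambda>x. rot2 i j g (r *\<^sub>R x))"
    "continuous_on (sphere 0 1) Y" "continuous_on (sphere 0 1) (rot i j Y)"
    "continuous_on (sphere 0 1) (rot2 i j Y)"
    by (auto intro!: continuous_on_sphere_scaled[of G] cg rG intro: continuous_on_subset[OF cY(1)]
        continuous_on_subset[OF cY(4)] continuous_on_subset[OF cY(5)])
  have d0: "((\<lambda>t. h (s *\<^sub>R rotflow i j t x)) has_vector_derivative rot i j h (s *\<^sub>R rotflow i j t x)) (at t)"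
    if "open H" "smooth_on H h" "s *\<^sub>R rotflow i j t x \<in> H" for h H s t and x :: "real^'n"
    using has_vector_derivative_along_rotflow[OF False smooth_on_has_derivative[OF that]]
    by (simp add: sum_rotgen rot_def)
  have d1: "((\<lambda>t. rot i j h (s *\<^sub>R rotflow i j t x)) has_vector_derivative rot2 i j h (s *\<^sub>R rotflow i j t x)) (at t)"
    if "open H" "smooth_on H h" "s *\<^sub>R rotflow i j t x \<in> H" for h H s t and x :: "real^'n"
    using has_derivative_rot[OF that] has_vector_derivative_along_rotflow[OF False] by metis
  have dg: "((\<lambda>t. g (r *\<^sub>R rotflow i j t x)) has_vector_derivative rot i j g (r *\<^sub>R rotflow i j t x)) (at t)"
    "((\<lambda>t. rot i j g (r *\<^sub>R rotflow i j t x)) has_vector_derivative rot2 i j g (r *\<^sub>R rotflow i j t x)) (at t)"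
    if "norm x = 1" for x t
    using that by (auto intro!: d0 d1 G g rG simp: nrm)
  have dY: "((\<lambda>t. cnj (Y (rotflow i j t x))) has_vector_derivative cnj (rot i j Y (rotflow i j t x))) (at t)"
    "((\<lambda>t. cnj (rot i j Y (rotflow i j t x))) has_vector_derivative cnj (rot2 i j Y (rotflow i j t x))) (at t)" for x t
    using d0[OF open_UNIV Y, of 1 t x] d1[OF open_UNIV Y, of 1 t x]
    by (auto intro: has_vector_derivative_cnj)
  have "sphere_integral (\<lambda>x. rot i j g (r *\<^sub>R x) * cnj (rot i j Y x) + rot2 i j g (r *\<^sub>R x) * cnj (Y x)) = 0"
    by (rule sphere_integral_rot_derivative[OF False, of "\<lambda>x. rot i j g (r *\<^sub>R x) * cnj (Y x)"])
      (intro has_vector_derivative_mult dg dY continuous_intros cont; assumption)+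
  moreover have "sphere_integral (\<lambda>x. g (r *\<^sub>R x) * cnj (rot2 i j Y x) + rot i j g (r *\<^sub>R x) * cnj (rot i j Y x)) = 0"
    by (rule sphere_integral_rot_derivative[OF False, of "\<lambda>x. g (r *\<^sub>R x) * cnj (rot i j Y x)"])
      (intro has_vector_derivative_mult dg dY continuous_intros cont; assumption)+
  moreover have "sphere_integral (\<lambda>x. rot i j g (r *\<^sub>R x) * cnj (rot i j Y x) + rot2 i j g (r *\<^sub>R x) * cnj (Y x))
      = sphere_integral (\<lambda>x. rot i j g (r *\<^sub>R x) * cnj (rot i j Y x)) + sphere_integral (\<lambda>x. rot2 i j g (r *\<^sub>R x) * cnj (Y x))"
    by (intro sphere_integral_add continuous_intros cont)
  moreover have "sphere_integral (\<lambda>x. g (r *\<^sub>R x) * cnj (rot2 i j Y x) + rot i j g (r *\<^sub>R x) * cnj (rot i j Y x))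
      = sphere_integral (\<lambda>x. g (r *\<^sub>R x) * cnj (rot2 i j Y x)) + sphere_integral (\<lambda>x. rot i j g (r *\<^sub>R x) * cnj (rot i j Y x))"
    by (intro sphere_integral_add continuous_intros cont)
  moreover have "b = c" if "z = 0" "w = 0" "z = a + b" "w = c + a" for a b c z w :: complex
    using that by (simp add: add_eq_0_iff2 add.commute)
  ultimately show ?thesis by blast
qed

lemma fcoef_has_vector_derivative:
  fixes h h' Y :: "real^'n \<Rightarrow> complex"
  assumes ab: "a < v" "v < b" and G: "\<And>t x. a \<le> t \<Longrightarrow> t \<le> b \<Longrightarrow> norm x = 1 \<Longrightarrow> exp t *\<^sub>R x \<in> G"
    and h: "continuous_on G h" and h': "continuous_on G h'" and Y: "continuous_on UNIV Y"
    and d: "\<And>t x. exp t *\<^sub>R x \<in> G \<Longrightarrow>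
      ((\<lambda>t. h (exp t *\<^sub>R x)) has_vector_derivative h' (exp t *\<^sub>R x)) (at t)"
  shows "((\<lambda>v. fcoef h Y (exp v)) has_vector_derivative fcoef h' Y (exp v)) (at v)"
  unfolding fcoef_def
proof (rule sphere_integral_has_vector_derivative[OF ab])
  show "((\<lambda>s. h (exp s *\<^sub>R x) * cnj (Y x)) has_vector_derivative h' (exp t *\<^sub>R x) * cnj (Y x)) (at t)"
    if "a \<le> t" "t \<le> b" "norm x = 1" for t x
    by (intro has_vector_derivative_mult_left d G that)
  show "continuous_on (sphere 0 1) (\<lambda>x. h (exp t *\<^sub>R x) * cnj (Y x))" if "a \<le> t" "t \<le> b" for t
    by (intro continuous_intros continuous_on_sphere_scaled[OF h] G that continuous_on_subset[OF Y]) auto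
  show "continuous_on ({a..b} \<times> sphere 0 1) (\<lambda>(t, x). h' (exp t *\<^sub>R x) * cnj (Y x))"
    unfolding case_prod_beta
    by (intro continuous_intros continuous_on_compose2[OF h'] continuous_on_compose2[OF Y]) (auto intro: G)
qed

lemma sphere_integral_lincomb3:
  fixes p q s :: "real^'n \<Rightarrow> complex"
  assumes "continuous_on (sphere 0 1) p" "continuous_on (sphere 0 1) q" "continuous_on (sphere 0 1) s"
  shows "sphere_integral (\<lambda>x. a * p x + (b * q x + c * s x))
    = a * sphere_integral p + (b * sphere_integral q + c * sphere_integral s)"
proof -
  have "continuous_on (sphere 0 1) (\<lambda>x. a * p x)" "continuous_on (sphere 0 1) (\<lambda>x. b * q x)"
    "continuous_on (sphere 0 1) (\<lambda>x. c * s x)"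
    by (intro continuous_on_mult_left assms)+
  then show ?thesis
    by (simp add: sphere_integral_add sphere_integral_cmult continuous_on_add)
qed

text \<open>Integrate \<open>laplacian_rot_identity\<close> against cnj Y and move the rotation
  fields onto Y, which is an eigenfunction with a real eigenvalue. The combination
  \<open>euler g x + hess g x\<close> stands for E applied twice.\<close>

lemma fcoef_spherical_ode:
  fixes g Y :: "real^'n \<Rightarrow> complex"
  assumes G: "open G" and g: "smooth_on G g" and rG: "\<And>x. norm x = 1 \<Longrightarrow> r *\<^sub>R x \<in> G"
    and Y: "harm_hom_poly k Y" and r: "0 \<le> r"
  shows "fcoef (\<lambda>x. euler g x + hess g x) Y r + of_real (real CARD('n) - 2) * fcoef (euler g) Y r
      - of_real (real k * (real k + real CARD('n) - 2)) * fcoef g Y r = of_real (r\<^sup>2) * fcoef (laplacian g) Y r"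
proof -
  have sY: "smooth_on UNIV Y"
    using Y unfolding harm_hom_poly_def by (intro smooth_on_cpoly cpoly_hom_poly) auto
  note cg = smooth_on_continuous[OF g] continuous_on_operators[OF G g] smooth_on_continuous[OF smooth_on_laplacian[OF G g]]
  have cont: "continuous_on (sphere 0 1) (\<lambda>x. h (r *\<^sub>R x) * cnj (Y x))" if "continuous_on G h" for h
    by (intro continuous_intros continuous_on_sphere_scaled[OF that] rG
        continuous_on_subset[OF smooth_on_continuous[OF sY]]) auto
  have cY: "continuous_on (sphere 0 1) (\<lambda>x. g (r *\<^sub>R x) * cnj (rot2 i j Y x))" for i j
    by (intro continuous_intros continuous_on_sphere_scaled[OF cg(1)] rG
        continuous_on_subset[OF continuous_on_operators(4)[OF open_UNIV sY]]) auto
  let ?d = "complex_of_real (real CARD('n))"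
  have "(\<Sum>i\<in>UNIV. \<Sum>j\<in>UNIV. sphere_integral (\<lambda>x. rot2 i j g (r *\<^sub>R x) * cnj (Y x)))
      = sphere_integral (\<lambda>x. (\<Sum>i\<in>UNIV. \<Sum>j\<in>UNIV. rot2 i j g (r *\<^sub>R x)) * cnj (Y x))"
    unfolding sum_distrib_right
    by (subst sphere_integral_sum; (intro continuous_on_sum cont cg finite)?)
      (subst sphere_integral_sum; (intro continuous_on_sum cont cg finite refl)?)
  also have "\<dots> = sphere_integral (\<lambda>x. (2 * of_real (r\<^sup>2)) * (laplacian g (r *\<^sub>R x) * cnj (Y x))
      + ((- 2 * (?d - 1)) * (euler g (r *\<^sub>R x) * cnj (Y x)) + (- 2) * (hess g (r *\<^sub>R x) * cnj (Y x))))"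
    by (rule sphere_integral_cong) (simp add: laplacian_rot_identity r algebra_simps)
  also have "\<dots> = (2 * of_real (r\<^sup>2)) * fcoef (laplacian g) Y r
      + ((- 2 * (?d - 1)) * fcoef (euler g) Y r + (- 2) * fcoef (hess g) Y r)"
    unfolding fcoef_def by (intro sphere_integral_lincomb3 cont cg)
  finally have 1: "(\<Sum>i\<in>UNIV. \<Sum>j\<in>UNIV. sphere_integral (\<lambda>x. rot2 i j g (r *\<^sub>R x) * cnj (Y x))) = \<dots>" .
  have "(\<Sum>i\<in>UNIV. \<Sum>j\<in>UNIV. sphere_integral (\<lambda>x. g (r *\<^sub>R x) * cnj (rot2 i j Y x)))
      = sphere_integral (\<lambda>x. g (r *\<^sub>R x) * cnj (\<Sum>i\<in>UNIV. \<Sum>j\<in>UNIV. rot2 i j Y x))"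
    unfolding sum_distrib_left cnj_sum
    by (subst sphere_integral_sum; (intro continuous_on_sum cY finite)?)
      (subst sphere_integral_sum; (intro continuous_on_sum cY finite refl)?)
  also have "\<dots> = sphere_integral (\<lambda>x. (- of_real (2 * real k * (real k + real CARD('n) - 2))) * (g (r *\<^sub>R x) * cnj (Y x)))"
    by (rule sphere_integral_cong) (simp add: harm_hom_poly_rot2[OF Y])
  also have "\<dots> = - of_real (2 * real k * (real k + real CARD('n) - 2)) * fcoef g Y r"
    unfolding fcoef_def by (rule sphere_integral_cmult)
  finally have 2: "(\<Sum>i\<in>UNIV. \<Sum>j\<in>UNIV. sphere_integral (\<lambda>x. g (r *\<^sub>R x) * cnj (rot2 i j Y x))) = \<dots>" .
  have 3: "fcoef (\<lambda>x. euler g x + hess g x) Y r = fcoef (euler g) Y r + fcoef (hess g) Y r"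
    unfolding fcoef_def distrib_right by (intro sphere_integral_add cont cg)
  have adj: "sphere_integral (\<lambda>x. rot2 i j g (r *\<^sub>R x) * cnj (Y x)) =
    sphere_integral (\<lambda>x. g (r *\<^sub>R x) * cnj (rot2 i j Y x))" for i j
    by (rule sphere_integral_rot2_adjoint[OF G g _ sY]) (rule rG)
  have "(2 * of_real (r\<^sup>2)) * fcoef (laplacian g) Y r
      + ((- 2 * (?d - 1)) * fcoef (euler g) Y r + (- 2) * fcoef (hess g) Y r)
      = - of_real (2 * real k * (real k + real CARD('n) - 2)) * fcoef g Y r"
    using 1 2 unfolding adj by (rule trans[OF sym])
  then have "2 * (fcoef (\<lambda>x. euler g x + hess g x) Y r + of_real (real CARD('n) - 2) * fcoef (euler g) Y r
      - of_real (real k * (real k + real CARD('n) - 2)) * fcoef g Y r) = 2 * (of_real (r\<^sup>2) * fcoef (laplacian g) Y r)"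
    unfolding 3 by (simp add: algebra_simps)
  then show ?thesis
    unfolding mult_cancel_left by simp
qed

section \<open>Bounds uniform in the spherical harmonic\<close>

text \<open>From 2 |Y| <= 1 + |Y|^2 and the normalisation of Y, the integral of |Y| is at most (area
  + 1) / 2, the same number for all spherical harmonics.\<close>

lemma norm_fcoef_le:
  fixes g Y :: "real^'n \<Rightarrow> complex"
  assumes Y: "continuous_on UNIV Y" "sph_inner Y Y = 1"
    and g: "continuous_on (sphere 0 1) (\<lambda>x. g (r *\<^sub>R x))"
    and S: "\<And>x. norm x = 1 \<Longrightarrow> cmod (g (r *\<^sub>R x)) \<le> S" "0 \<le> S"
  shows "cmod (fcoef g Y r) \<le> S * ((Re (sphere_integral (\<lambda>x::real^'n. 1)) + 1) / 2)"
proof -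
  have cY: "continuous_on (sphere 0 1) Y"
    by (rule continuous_on_subset[OF Y(1)]) auto
  let ?w = "\<lambda>x. S * ((1 + (cmod (Y x))\<^sup>2) / 2)"
  have "cmod (fcoef g Y r) \<le> Re (sphere_integral (\<lambda>x. complex_of_real (?w x)))"
    unfolding fcoef_def
  proof (rule norm_sphere_integral_le)
    fix x :: "real^'n" assume x: "norm x = 1"
    have "cmod (Y x) \<le> (1 + (cmod (Y x))\<^sup>2) / 2"
      using sum_squares_bound[of 1 "cmod (Y x)"] by simp
    then show "cmod (g (r *\<^sub>R x) * cnj (Y x)) \<le> ?w x"
      using S x by (simp only: norm_mult complex_mod_cnj) (intro mult_mono, auto)
  qed (intro continuous_intros g cY; simp)+
  also have "(\<lambda>x. complex_of_real (?w x)) = (\<lambda>x. complex_of_real (S / 2) * (1 + Y x * cnj (Y x)))"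
    by (simp add: complex_norm_square del: of_real_power)
  also have "sphere_integral \<dots> = complex_of_real (S / 2) * (sphere_integral (\<lambda>x::real^'n. 1) + 1)"
    using Y(2) by (simp only: sphere_integral_cmult sph_inner_def)
      (subst sphere_integral_add; (intro continuous_intros cY)?; simp)
  finally show ?thesis by simp
qed

text \<open>Compare \<open>(v - a) e\<^bsup>\<mu>(v-b)\<^esup> (F1 v - k F v) - e\<^bsup>\<mu>(v-b)\<^esup> F v\<close>, whose derivative contains neither \<open>F1\<close>
  nor \<open>F2\<close>, with \<open>(b - a) H v + 2 S e\<^bsup>\<mu>(v-b)\<^esup>\<close>.\<close>
lemma first_order_ode_bound:
  fixes F F1 F2 h :: "real \<Rightarrow> complex"
  assumes ab: "a < b" and k: "0 \<le> k" "k \<le> \<mu>"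
    and F: "\<And>v. a \<le> v \<Longrightarrow> v \<le> b \<Longrightarrow> (F has_vector_derivative F1 v) (at v)"
    and F1: "\<And>v. a \<le> v \<Longrightarrow> v \<le> b \<Longrightarrow> (F1 has_vector_derivative F2 v) (at v)"
    and ode: "\<And>v. a \<le> v \<Longrightarrow> v \<le> b \<Longrightarrow> (F2 v - of_real k * F1 v) + of_real \<mu> * (F1 v - of_real k * F v) = h v"
    and S: "\<And>v. a \<le> v \<Longrightarrow> v \<le> b \<Longrightarrow> cmod (F v) \<le> S"
    and H: "\<And>v. a \<le> v \<Longrightarrow> v \<le> b \<Longrightarrow> cmod (h v) \<le> H"
  shows "cmod (F1 b - of_real k * F b) \<le> (b - a) * H + 4 * S / (b - a)"
proof -
  define G where "G v = F1 v - of_real k * F v" for v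
  define E where "E v = exp (\<mu> * (v - b))" for v
  \<comment> \<open>The factor \<open>v - a\<close> removes the unknown value \<open>G a\<close>,
    while \<open>G b\<close> survives with weight \<open>b - a\<close>; \<open>E\<close> is the
    integrating factor, normalised to 1 at \<open>b\<close>.\<close>
  define \<Psi> where "\<Psi> v = (E v * (v - a)) *\<^sub>R G v - E v *\<^sub>R F v" for v
  define \<Psi>' where "\<Psi>' v = E v *\<^sub>R (of_real (v - a) * h v - of_real (\<mu> + k) * F v)" for v
  define \<phi> where "\<phi> v = (b - a) * H * v + 2 * S * E v" for v
  have dE: "(E has_real_derivative \<mu> * E v) (at v)" for v
    unfolding E_def by (auto intro!: derivative_eq_intros)
  have dG: "(G has_vector_derivative F2 v - of_real k * F1 v) (at v)" if "a \<le> v" "v \<le> b" for v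
    unfolding G_def by (intro derivative_intros F F1 that)
  have d\<Psi>: "(\<Psi> has_vector_derivative \<Psi>' v) (at v)" if v: "a \<le> v" "v \<le> b" for v
  proof -
    have "((\<lambda>v. E v * (v - a)) has_real_derivative \<mu> * E v * (v - a) + E v) (at v)"
      by (auto intro!: derivative_eq_intros dE)
    then have "(\<Psi> has_vector_derivative
       ((E v * (v - a)) *\<^sub>R (F2 v - of_real k * F1 v) + (\<mu> * E v * (v - a) + E v) *\<^sub>R G v)
       - (E v *\<^sub>R F1 v + (\<mu> * E v) *\<^sub>R F v)) (at v)"
      unfolding \<Psi>_def by (intro derivative_intros dG F v dE)
    moreover have "((E v * (v - a)) *\<^sub>R (F2 v - of_real k * F1 v) + (\<mu> * E v * (v - a) + E v) *\<^sub>R G v)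
       - (E v *\<^sub>R F1 v + (\<mu> * E v) *\<^sub>R F v) = \<Psi>' v"
      unfolding \<Psi>'_def ode[OF v, symmetric] G_def by (simp add: scaleR_conv_of_real algebra_simps)
    ultimately show ?thesis by simp
  qed
  have d\<phi>: "(\<phi> has_vector_derivative (b - a) * H + 2 * S * (\<mu> * E v)) (at v)" for v
    unfolding \<phi>_def has_real_derivative_iff_has_vector_derivative[symmetric]
    by (auto intro!: derivative_eq_intros dE)
  have "norm (\<Psi> b - \<Psi> a) \<le> \<phi> b - \<phi> a"
  proof (rule differentiable_bound_general[OF ab])
    show "continuous_on {a..b} \<Psi>"
      by (intro continuous_at_imp_continuous_on ballI has_vector_derivative_continuous[OF d\<Psi>]) auto
    show "continuous_on {a..b} \<phi>"
      by (intro continuous_at_imp_continuous_on ballI has_vector_derivative_continuous[OF d\<phi>])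
    fix v assume v: "a < v" "v < b"
    have E: "0 < E v" "E v \<le> 1"
      using v k by (auto simp: E_def mult_nonneg_nonpos)
    have "cmod (of_real (v - a) * h v - of_real (\<mu> + k) * F v) \<le> (v - a) * cmod (h v) + (\<mu> + k) * cmod (F v)"
      using norm_triangle_ineq4[of "of_real (v - a) * h v" "of_real (\<mu> + k) * F v"] v k
      unfolding norm_mult norm_of_real by simp
    \<comment> \<open>Here \<open>k \<le> \<mu>\<close> is used. Below, only the \<open>H\<close>
      term uses \<open>E v \<le> 1\<close>. The \<open>S\<close> term keeps its weight, because 2 S
      mu \<open>E v\<close> is the derivative of 2 S \<open>E v\<close> and integrates to at most 2
      S however large mu is.\<close>
    also have "\<dots> \<le> (b - a) * H + (2 * \<mu>) * S"
      using v k S[of v] H[of v] by (intro add_mono mult_mono) auto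
    finally have "norm (\<Psi>' v) \<le> E v * ((b - a) * H + (2 * \<mu>) * S)"
      unfolding \<Psi>'_def using E by simp
    also have "\<dots> \<le> 1 * ((b - a) * H) + 2 * S * (\<mu> * E v)"
    proof -
      have "0 \<le> (b - a) * H"
        using v H[of v] norm_ge_zero[of "h v"] by (intro mult_nonneg_nonneg) linarith+
      from mult_right_mono[OF E(2) this] show ?thesis
        by (simp add: algebra_simps)
    qed
    finally show "norm (\<Psi>' v) \<le> (b - a) * H + 2 * S * (\<mu> * E v)" by simp
  qed (auto intro: d\<Psi> d\<phi>)
  \<comment> \<open>The final 4 S is the 2 S from here plus one S each for \<open>F b\<close> and
    \<open>E a *\<^sub>R F a\<close>.\<close>
  moreover have "\<phi> b - \<phi> a \<le> (b - a) * ((b - a) * H) + 2 * S"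
    using order_trans[OF norm_ge_zero S[of a]] ab by (simp add: \<phi>_def E_def algebra_simps)
  moreover have "\<Psi> b - \<Psi> a = of_real (b - a) * G b - F b + E a *\<^sub>R F a"
    by (simp add: \<Psi>_def E_def scaleR_conv_of_real)
  moreover have "cmod (E a *\<^sub>R F a) \<le> S"
  proof -
    have "E a \<le> 1" "0 \<le> E a" using ab k by (auto simp: E_def mult_nonneg_nonpos)
    then have "E a * cmod (F a) \<le> 1 * S"
      using S[of a] ab by (intro mult_mono) auto
    then show ?thesis using \<open>0 \<le> E a\<close> by simp
  qed
  moreover have "cmod (F b) \<le> S"
    using S[of b] ab by simp
  moreover have "cmod (of_real (b - a) * G b) \<le> cmod (of_real (b - a) * G b - F b + E a *\<^sub>R F a) + cmod (F b) + cmod (E a *\<^sub>R F a)"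
  proof -
    have "cmod z \<le> cmod (z - x + y) + cmod x + cmod y" for x y z
      using norm_triangle_ineq[of "z - x + y" x] norm_triangle_ineq4[of "z + y" y]
      by (simp add: algebra_simps)
    then show ?thesis .
  qed
  ultimately have "cmod (of_real (b - a) * G b) \<le> (b - a) * ((b - a) * H) + 4 * S"
    by simp
  then have "(b - a) * cmod (G b) \<le> (b - a) * ((b - a) * H + 4 * S / (b - a))"
    using ab by (simp only: norm_mult norm_of_real) (simp add: distrib_left)
  then show ?thesis
    using ab unfolding G_def by (simp add: mult_le_cancel_left_pos)
qed

text \<open>The factor e^(2pv) absorbs the shift 2p in both exponents of the p-th pair: d/dv - k -
  2p acts on e^(2pv) F_p as d/dv - k acts on F_p, and likewise for the odd exponent. Each pair is
  thus one application of the differential equation, which contributes e^(2v).\<close>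

lemma Dop_lam_eq:
  fixes F F1 F2 :: "nat \<Rightarrow> real \<Rightarrow> complex"
  assumes I: "open I"
    and F: "\<And>p v. v \<in> I \<Longrightarrow> (F p has_vector_derivative F1 p v) (at v)"
    and F1: "\<And>p v. v \<in> I \<Longrightarrow> (F1 p has_vector_derivative F2 p v) (at v)"
    and ode: "\<And>p v. v \<in> I \<Longrightarrow> F2 p v + of_real (real d - 2) * F1 p v
        - of_real (real k * (real k + real d - 2)) * F p v = of_real ((exp v)\<^sup>2) * F (Suc p) v"
  shows "(\<forall>v\<in>I. Dop (lam k d) (2 * p) (F 0) v = of_real (exp v ^ (2 * p)) * F p v) \<and>
    (\<forall>v\<in>I. Dop (lam k d) (Suc (2 * p)) (F 0) v = of_real (exp v ^ (2 * p)) * (F1 p v - of_real (real k) * F p v))"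
proof -
  have dexp: "((\<lambda>v. complex_of_real (exp v ^ m)) has_vector_derivative of_real (real m * exp v ^ m)) (at v)" for m v
  proof -
    have "((\<lambda>v. exp v ^ m) has_real_derivative real m * exp v ^ m) (at v)"
      unfolding exp_of_nat_mult[symmetric] by (auto intro!: derivative_eq_intros)
    then show ?thesis
      by (intro has_vector_derivative_of_real) (simp add: has_real_derivative_iff_has_vector_derivative)
  qed
  \<comment> \<open>The formula for \<open>Dop L n g\<close> is known on \<open>I\<close> only;
    openness of \<open>I\<close> lets it be differentiated there.\<close>
  have step: "Dop L (Suc n) g v = D - of_real (L n) * h v"
    if "\<And>v. v \<in> I \<Longrightarrow> Dop L n g v = h v" "v \<in> I" "(h has_vector_derivative D) (at v)" for L n g h D v
  proof -
    have "(Dop L n g has_vector_derivative D) (at v)"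
      using has_vector_derivative_transform_within_open[OF that(3) I that(2)] that(1) by simp
    then show ?thesis
      using that by (simp add: vector_derivative_at)
  qed
  have odd: "\<forall>v\<in>I. Dop (lam k d) (Suc (2 * p)) (F 0) v = of_real (exp v ^ (2 * p)) * (F1 p v - of_real (real k) * F p v)"
    if even: "\<forall>v\<in>I. Dop (lam k d) (2 * p) (F 0) v = of_real (exp v ^ (2 * p)) * F p v" for p
  proof
    fix v assume v: "v \<in> I"
    show "Dop (lam k d) (Suc (2 * p)) (F 0) v = of_real (exp v ^ (2 * p)) * (F1 p v - of_real (real k) * F p v)"
      by (subst step[OF bspec[OF even] v has_vector_derivative_mult[OF dexp F[OF v]]], assumption)
        (simp add: lam_def algebra_simps)
  qed
  show ?thesis
  proof (induction p)
    case 0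
    then show ?case using odd[of 0] by simp
  next
    case (Suc p)
    have "\<forall>v\<in>I. Dop (lam k d) (2 * Suc p) (F 0) v = of_real (exp v ^ (2 * Suc p)) * F (Suc p) v"
    proof
      fix v assume v: "v \<in> I"
      let ?e = "complex_of_real (exp v ^ (2 * p))"
      have dG: "((\<lambda>v. F1 p v - of_real (real k) * F p v) has_vector_derivative F2 p v - of_real (real k) * F1 p v) (at v)"
        by (intro derivative_intros F F1 v)
      have "Dop (lam k d) (Suc (Suc (2 * p))) (F 0) v =
         ?e * (F2 p v - of_real (real k) * F1 p v) + of_real (real (2 * p) * exp v ^ (2 * p)) * (F1 p v - of_real (real k) * F p v)
           - of_real (lam k d (Suc (2 * p))) * (?e * (F1 p v - of_real (real k) * F p v))"
        by (rule step[OF bspec[OF conjunct2[OF Suc.IH]] v has_vector_derivative_mult[OF dexp dG]])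
      also have "\<dots> = ?e * (F2 p v + of_real (real d - 2) * F1 p v
        - of_real (real k * (real k + real d - 2)) * F p v)"
        by (simp add: lam_def algebra_simps)
      also have "\<dots> = of_real (exp v ^ (2 * Suc p)) * F (Suc p) v"
        unfolding ode[OF v] by (simp add: power2_eq_square)
      finally show "Dop (lam k d) (2 * Suc p) (F 0) v = of_real (exp v ^ (2 * Suc p)) * F (Suc p) v"
        by simp
    qed
    then show ?case using odd by blast
  qed
qed

lemma open_annulus: "open (annulus r0 r1 :: (real^'n) set)"
proof -
  have "(annulus r0 r1 :: (real^'n) set) = {x. r0 < norm x} \<inter> {x. ereal (norm x) < r1}"
    by (auto simp: annulus_def)
  then show ?thesis
    by (simp only:) (intro open_Int open_Collect_less continuous_intros)
qed

text \<open>Bernoulli's inequality for the ratio of \<open>\<rho>\<close> to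
  \<open>\<sigma>\<close>. It pays for the factor 2p+2 by which (2p+2)! exceeds (2p+1)!.\<close>

lemma linear_power_le:
  fixes \<sigma> \<rho> :: real
  assumes "0 < \<sigma>" "\<sigma> < \<rho>"
  shows "real m * \<sigma> ^ m \<le> \<rho> ^ m / (\<rho> / \<sigma> - 1)"
proof -
  define x where "x = \<rho> / \<sigma> - 1"
  have x: "0 < x" using assms by (simp add: x_def)
  have "real m * x \<le> (1 + x) ^ m"
    using Bernoulli_inequality[of x m] x by simp
  then have "real m * x * \<sigma> ^ m \<le> (1 + x) ^ m * \<sigma> ^ m"
    using assms by (intro mult_right_mono) auto
  also have "\<dots> = \<rho> ^ m"
    using assms by (simp add: x_def flip: power_mult_distrib)
  finally show ?thesis
    using x unfolding x_def[symmetric] by (simp add: pos_le_divide_eq mult_ac)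
qed

theorem mainTheorem11:
  fixes f :: "real^'n \<Rightarrow> complex" and r0 :: real and r1 :: ereal and \<tau> :: real
    and Y :: "nat \<Rightarrow> nat \<Rightarrow> real^'n \<Rightarrow> complex" and a :: "nat \<Rightarrow> nat"
  assumes "CARD('n) \<ge> 2"
    and "0 \<le> r0" and "ereal r0 < r1" and "\<tau> \<ge> 0"
    and "polyharmonic_inf (annulus r0 r1) \<tau> f"
    and "\<And>k. sph_harm_onb k (a k) (Y k)"
  shows "\<forall>v0::real. r0 < exp v0 \<and> ereal (exp v0) < r1 \<longrightarrow>
           (\<forall>\<epsilon>>0. \<exists>C>0. \<forall>n k l. l \<in> {1..a k} \<longrightarrow>
              cmod (Dop (lam k CARD('n)) n (\<lambda>v. fcoef f (Y k l) (exp v)) v0)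
                \<le> C * fact n * (exp v0 * (\<tau> + \<epsilon>)) ^ n)"
proof (intro allI impI)
  fix v0 \<epsilon> :: real
  assume v0: "r0 < exp v0 \<and> ereal (exp v0) < r1" and \<epsilon>: "0 < \<epsilon>"
  let ?G = "annulus r0 r1 :: (real^'n) set"
  let ?d = "CARD('n)"
  define g where "g p = (laplacian ^^ p) f" for p
  have sg: "smooth_on ?G (g p)" for p
    using assms(5) unfolding g_def polyharmonic_inf_def by (auto intro: smooth_on_laplacian_funpow open_annulus)
  define I where "I = {v::real. r0 < exp v \<and> ereal (exp v) < r1}"
  have I: "open I"
  proof -
    have "I = {v. r0 < exp v} \<inter> {v. ereal (exp v) < r1}"
      by (auto simp: I_def)
    then show ?thesis
      by (simp only:) (intro open_Int open_Collect_less continuous_intros)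
  qed
  have IG: "exp v *\<^sub>R x \<in> ?G" if "v \<in> I" "norm x = 1" for v x
    using that by (simp add: I_def annulus_def)
  have Iball: "\<exists>c b. c < v \<and> v < b \<and> {c..b} \<subseteq> I" if v: "v \<in> I" for v
  proof -
    obtain e where "e > 0" "cball v e \<subseteq> I"
      using I v unfolding open_contains_cball by blast
    then show ?thesis
      by (intro exI[of _ "v - e"] exI[of _ "v + e"]) (auto simp: cball_eq_atLeastAtMost)
  qed
  \<comment> \<open>The hypothesis on f is used on the closed shell over [c, b]; its part [c, v0]
    carries the odd-order estimate.\<close>
  obtain c b where cb: "c < v0" "v0 < b" "{c..b} \<subseteq> I"
    using Iball[of v0] v0 by (auto simp: I_def)
  define K where "K = {x::real^'n. exp c \<le> norm x \<and> norm x \<le> exp b}"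
  have "compact K"
  proof -
    have "closed K"
      unfolding K_def by (auto intro!: closed_Collect_conj closed_Collect_le continuous_intros)
    moreover have "K \<subseteq> cball 0 (exp b)"
      by (auto simp: K_def)
    ultimately show ?thesis
      by (meson bounded_cball bounded_subset compact_eq_bounded_closed)
  qed
  moreover have "K \<subseteq> ?G"
  proof
    fix x assume x: "x \<in> K"
    then have "0 < norm x"
      using exp_gt_zero[of c] unfolding K_def mem_Collect_eq by linarith
    then have "exp (ln (norm x)) = norm x"
      by simp
    moreover from this have "ln (norm x) \<in> {c..b}"
      using x unfolding K_def by (metis (mono_tags) atLeastAtMost_iff exp_le_cancel_iff mem_Collect_eq)
    ultimately show "x \<in> ?G"
      using cb(3) by (force simp: I_def annulus_def)
  qed
  moreover have "0 < \<epsilon> / 2" using \<epsilon> by simp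
  ultimately obtain C where C: "0 < C" "\<And>p x. x \<in> K \<Longrightarrow>
      cmod (g p x) \<le> C * fact (2*p) * (\<tau> + \<epsilon> / 2) ^ (2*p)"
    using assms(5) unfolding polyharmonic_inf_def g_def by meson
  have Kmem: "exp v *\<^sub>R x \<in> K" if "c \<le> v" "v \<le> b" "norm x = 1" for v x
    using that by (simp add: K_def)
  define \<rho> where "\<rho> = \<tau> + \<epsilon>"
  \<comment> \<open>The growth rate actually taken from the hypothesis; the gap to
    \<open>\<rho>\<close> is what \<open>linear_power_le\<close> consumes.\<close>
  define \<sigma> where "\<sigma> = \<tau> + \<epsilon> / 2"
  have \<rho>\<sigma>: "0 < \<sigma>" "\<sigma> < \<rho>" "0 < \<rho>"
    using assms(4) \<epsilon> by (auto simp: \<rho>_def \<sigma>_def)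
  \<comment> \<open>The constant of \<open>norm_fcoef_le\<close>; the maximum with 0 makes its sign
    evident.\<close>
  define M where "M = max 0 ((Re (sphere_integral (\<lambda>x::real^'n. 1)) + 1) / 2)"
  define \<beta> where "\<beta> = v0 - c"
  have \<beta>: "0 < \<beta>" using cb by (simp add: \<beta>_def)
  define X where "X = \<rho> / \<sigma> - 1"
  have X: "0 < X" using \<rho>\<sigma> by (simp add: X_def)
  define A where "A = C * M"
  have A: "0 \<le> A" using C by (simp add: A_def M_def)
  \<comment> \<open>\<open>A\<close> serves even orders. The next two terms are 4 S /
    \<open>\<beta>\<close> and \<open>\<beta>\<close> H from \<open>first_order_ode_bound\<close> on
    an interval of length \<open>\<beta>\<close>, divided by n! (e^v0 \<open>\<rho>\<close>)^n with
    n = 2p+1; the final 1 ensures positivity. Neither n, k nor l enters.\<close>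
  define C' where "C' = A + 4 * A / (\<beta> * (exp v0 * \<rho>)) + \<beta> * (A * (exp b)\<^sup>2 * \<rho> / (exp v0 * X)) + 1"
  have parts: "0 \<le> 4 * A / (\<beta> * (exp v0 * \<rho>))" "0 \<le> \<beta> * (A * (exp b)\<^sup>2 * \<rho> / (exp v0 * X))"
    using A \<beta> \<rho>\<sigma> X by simp_all
  show "\<exists>C>0. \<forall>n k l. l \<in> {1..a k} \<longrightarrow>
              cmod (Dop (lam k ?d) n (\<lambda>v. fcoef f (Y k l) (exp v)) v0)
                \<le> C * fact n * (exp v0 * (\<tau> + \<epsilon>)) ^ n"
  proof (intro exI[of _ C'] conjI allI impI)
    show "0 < C'" using parts A unfolding C'_def by linarith
    fix n k l assume l: "l \<in> {1..a k}"
    have Y: "harm_hom_poly k (Y k l)" "sph_inner (Y k l) (Y k l) = 1"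
      using assms(6)[of k] l unfolding sph_harm_onb_def by auto
    have cY: "continuous_on UNIV (Y k l)"
      using Y(1) unfolding harm_hom_poly_def by (intro cpoly_continuous cpoly_hom_poly) auto
    define F where "F p v = fcoef (g p) (Y k l) (exp v)" for p v
    define F1 where "F1 p v = fcoef (euler (g p)) (Y k l) (exp v)" for p v
    define F2 where "F2 p v = fcoef (\<lambda>x. euler (g p) x + hess (g p) x) (Y k l) (exp v)" for p v
    note op = continuous_on_operators[OF open_annulus sg]
    have dF: "(F p has_vector_derivative F1 p v) (at v)"
      and dF1: "(F1 p has_vector_derivative F2 p v) (at v)" if v: "v \<in> I" for p v
    proof -
      obtain s t where st: "s < v" "v < t" "{s..t} \<subseteq> I"
        using Iball[OF v] by blast
      then have st': "s \<le> w \<Longrightarrow> w \<le> t \<Longrightarrow> norm x = 1 \<Longrightarrow> exp w *\<^sub>R x \<in> ?G" for w x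
        by (intro IG) auto
      show "(F p has_vector_derivative F1 p v) (at v)"
        unfolding F_def F1_def
        by (rule fcoef_has_vector_derivative[OF st(1,2) st' smooth_on_continuous[OF sg] op(1) cY
              has_vector_derivative_along_euler(1)[OF open_annulus sg]])
      show "(F1 p has_vector_derivative F2 p v) (at v)"
        unfolding F1_def F2_def
        by (rule fcoef_has_vector_derivative[OF st(1,2) st' op(1) continuous_on_add[OF op(1,2)] cY
              has_vector_derivative_along_euler(2)[OF open_annulus sg]])
    qed
    have ode: "F2 p v + of_real (real ?d - 2) * F1 p v
        - of_real (real k * (real k + real ?d - 2)) * F p v = of_real ((exp v)\<^sup>2) * F (Suc p) v" if v: "v \<in> I" for p v
      using fcoef_spherical_ode[OF open_annulus sg IG[OF v] Y(1), of p]
      unfolding F_def F1_def F2_def g_def by simp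
    have Fbound: "cmod (F p v) \<le> A * fact (2*p) * \<sigma> ^ (2*p)" if v: "c \<le> v" "v \<le> b" for p v
    proof -
      have vI: "v \<in> I" using v cb by auto
      have "cmod (F p v) \<le> (C * fact (2*p) * \<sigma> ^ (2*p)) * ((Re (sphere_integral (\<lambda>x::real^'n. 1)) + 1) / 2)"
        unfolding F_def \<sigma>_def
      proof (rule norm_fcoef_le[OF cY Y(2)])
        show "continuous_on (sphere 0 1) (\<lambda>x. g p (exp v *\<^sub>R x))"
          by (rule continuous_on_sphere_scaled[OF smooth_on_continuous[OF sg] IG[OF vI]])
      qed (use C Kmem v assms(4) \<epsilon> in auto)
      also have "\<dots> \<le> (C * fact (2*p) * \<sigma> ^ (2*p)) * M"
        unfolding M_def using C \<rho>\<sigma> by (intro mult_left_mono) auto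
      finally show ?thesis by (simp add: A_def mult_ac)
    qed
    have F0: "(\<lambda>v. fcoef f (Y k l) (exp v)) = F 0"
      by (simp add: F_def[abs_def] g_def)
    have v0I: "v0 \<in> I" using cb by auto
    note Dop = Dop_lam_eq[where F=F and ?F1.0=F1 and ?F2.0=F2 and k=k and d="?d", OF I dF dF1 ode]
    let ?t = "\<lambda>n. fact n * (exp v0 * \<rho>) ^ n :: real"
    have main: "cmod (Dop (lam k ?d) n (F 0) v0) \<le> C' * ?t n"
    proof (cases "even n")
      case True
      then obtain p where n: "n = 2 * p" by blast
      have "cmod (Dop (lam k ?d) n (F 0) v0) = exp v0 ^ n * cmod (F p v0)"
        using Dop[of p] v0I unfolding n by (simp add: norm_mult norm_power)
      also have "\<dots> \<le> exp v0 ^ n * (A * fact n * \<sigma> ^ n)"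
        using Fbound[of v0 p] cb unfolding n by (intro mult_left_mono) auto
      also have "\<dots> \<le> exp v0 ^ n * (A * fact n * \<rho> ^ n)"
        using A \<rho>\<sigma> by (intro mult_left_mono power_mono) auto
      also have "\<dots> = A * ?t n"
        by (simp add: power_mult_distrib)
      also have "\<dots> \<le> C' * ?t n"
        using parts \<rho>\<sigma> unfolding C'_def by (intro mult_right_mono) auto
      finally show ?thesis .
    next
      case False
      then obtain p where n: "n = Suc (2 * p)" by (auto elim: oddE)
      define S where "S = A * fact (2*p) * \<sigma> ^ (2*p)"
      define H where "H = (exp b)\<^sup>2 * (A * fact (2 * Suc p) * \<sigma> ^ (2 * Suc p))"
      have odd: "cmod (F1 p v0 - of_real (real k) * F p v0) \<le> (v0 - c) * H + 4 * S / (v0 - c)"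
      proof (rule first_order_ode_bound[OF cb(1), where \<mu>="real k + real ?d - 2"
            and ?F2.0="F2 p" and h="\<lambda>v. of_real ((exp v)\<^sup>2) * F (Suc p) v"])
        \<comment> \<open>The dimension hypothesis d >= 2 enters here.\<close>
        show "real k \<le> real k + real ?d - 2"
          using assms(1) by simp
        fix v assume v: "c \<le> v" "v \<le> v0"
        then have vI: "v \<in> I" using cb by auto
        show "(F p has_vector_derivative F1 p v) (at v)" "(F1 p has_vector_derivative F2 p v) (at v)"
          by (rule dF[OF vI] dF1[OF vI])+
        show "(F2 p v - of_real (real k) * F1 p v) + of_real (real k + real ?d - 2) * (F1 p v - of_real (real k) * F p v)
            = of_real ((exp v)\<^sup>2) * F (Suc p) v"
          unfolding ode[OF vI, symmetric] by (simp add: algebra_simps)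
        show "cmod (F p v) \<le> S"
          unfolding S_def using v cb by (intro Fbound) auto
        have "(exp v)\<^sup>2 * cmod (F (Suc p) v) \<le> H"
          unfolding H_def using v cb by (intro mult_mono Fbound power_mono) auto
        then show "cmod (of_real ((exp v)\<^sup>2) * F (Suc p) v) \<le> H"
          by (simp only: norm_mult norm_of_real) simp
      qed simp
      have S: "S \<le> A * (fact n * \<rho> ^ n / \<rho>)"
      proof -
        have "fact (2*p) * \<sigma> ^ (2*p) \<le> fact n * \<rho> ^ (2*p)"
          using \<rho>\<sigma> unfolding n by (intro mult_mono power_mono fact_mono) auto
        also have "\<dots> = fact n * \<rho> ^ n / \<rho>"
          using \<rho>\<sigma> by (simp add: n)
        finally show ?thesis
          unfolding S_def mult.assoc using A by (intro mult_left_mono)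
      qed
      have H: "H \<le> (exp b)\<^sup>2 * (A * (fact n * (\<rho> ^ n * \<rho> / X)))"
      proof -
        \<comment> \<open>F_(p+1) brings (2p+2)!, one factor more than n! allows; the surplus 2p+2
          is traded for the step from \<open>\<sigma>\<close> to \<open>\<rho>\<close>.\<close>
        have "fact (2 * Suc p) * \<sigma> ^ (2 * Suc p) = fact n * (real (2 * Suc p) * \<sigma> ^ (2 * Suc p))"
          by (simp add: n)
        also have "\<dots> \<le> fact n * (\<rho> ^ (2 * Suc p) / X)"
          unfolding X_def by (intro mult_left_mono linear_power_le \<rho>\<sigma>) auto
        also have "\<rho> ^ (2 * Suc p) = \<rho> ^ n * \<rho>"
          by (simp add: n)
        finally show ?thesis
          unfolding H_def mult.assoc using A by (intro mult_left_mono) auto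
      qed
      have "cmod (Dop (lam k ?d) n (F 0) v0) = exp v0 ^ (2*p) * cmod (F1 p v0 - of_real (real k) * F p v0)"
        using Dop[of p] v0I unfolding n by (simp add: norm_mult norm_power del: Dop.simps)
      also have "\<dots> \<le> exp v0 ^ (2*p) * (\<beta> * ((exp b)\<^sup>2 * (A * (fact n * (\<rho> ^ n * \<rho> / X)))) + 4 * (A * (fact n * \<rho> ^ n / \<rho>)) / \<beta>)"
        using odd S H \<beta> unfolding \<beta>_def[symmetric]
        by (intro mult_left_mono order_trans[OF odd[folded \<beta>_def]] add_mono divide_right_mono) auto
      also have "\<dots> = (\<beta> * (A * (exp b)\<^sup>2 * \<rho> / (exp v0 * X)) + 4 * A / (\<beta> * (exp v0 * \<rho>))) * ?t n"
        using \<beta> \<rho>\<sigma> X by (simp add: n power_mult_distrib field_simps)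
      also have "\<dots> \<le> C' * ?t n"
        using A \<rho>\<sigma> unfolding C'_def by (intro mult_right_mono) auto
      finally show ?thesis .
    qed
    then show "cmod (Dop (lam k ?d) n (\<lambda>v. fcoef f (Y k l) (exp v)) v0)
                \<le> C' * fact n * (exp v0 * (\<tau> + \<epsilon>)) ^ n"
      by (simp add: F0 \<rho>_def mult.assoc)
  qed
qed

end
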